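(* Let $\alpha,\beta,\gamma,\delta\in\mathbb{R}$ with $\alpha+\delta\neq0$ and $\alpha\gamma-\beta\delta=0$, and let $(G_6,g,J)$ be the connected three-dimensional non-unimodular Lie group with left-invariant Lorentzian metric $g$ whose Lie algebra has a pseudo-orthonormal basis $\{e_1,e_2,e_3\}$, $e_3$ timelike, with $$[e_1,e_2]=\alpha e_2+\beta e_3,\quad [e_1,e_3]=\gamma e_2+\delta e_3,\quad [e_2,e_3]=0,$$ and with the product structure $J$ given by $Je_1=e_1$, $Je_2=e_2$, $Je_3=-e_3$. Then $(G_6,g,J)$ admits left-invariant Ricci collineations associated to the canonical connection $\nabla^0$ if and only if one of the following holds, and in each case the space $\mathbb{V}_{\mathbb{RC}}$ of these collineations is as indicated: (1) $\gamma=0$, $\alpha(2\alpha^2-\beta^2)=0$, with $\mathbb{V}_{\mathbb{RC}}=\langle e_1,e_2,e_3\rangle$; (2) $\gamma=0$, $\alpha(2\alpha^2-\beta^2)\neq0$, with $\mathbb{V}_{\mathbb{RC}}=\langle e_3\rangle$; (3) $\gamma\neq0$, $\alpha=\beta=0$, $\delta\neq0$, with $\mathbb{V}_{\mathbb{RC}}=\langle e_2\rangle$ (i.e. $\lambda_1=\lambda_3=0$); (4) $\gamma\neq0$, $\alpha\neq0$, $\alpha+\beta=0$, $\gamma+\delta=0$, $\delta\neq0$, with $\mathbb{V}_{\mathbb{RC}}=\langle e_2+\frac{\alpha}{\delta}e_3\rangle$ (i.e. $\lambda_1=0$, $\lambda_3=\frac{\alpha}{\delta}\lambda_2$); (5)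 $\gamma\neq0$, $\alpha\neq0$, $\alpha=\beta$, $\gamma=\delta$, $\delta\neq0$, with $\mathbb{V}_{\mathbb{RC}}=\langle e_2-\frac{\alpha}{\delta}e_3\rangle$ (i.e. $\lambda_1=0$, $\lambda_3=-\frac{\alpha}{\delta}\lambda_2$).
   Context: Pseudo-orthonormal with $e_3$ timelike means $g(e_1,e_1)=g(e_2,e_2)=1$, $g(e_3,e_3)=-1$, $g(e_i,e_j)=0$ for $i\ne j$. $J$ is extended left-invariantly to a $(1,1)$-tensor with $J^2=\mathrm{id}$. Let $\nabla$ be the Levi-Civita connection of $g$. The canonical connection is $$\nabla^0_XY=\nabla_XY-\tfrac12(\nabla_XJ)JY,$$ with curvature $R^0(X,Y)Z=\nabla^0_X\nabla^0_YZ-\nabla^0_Y\nabla^0_XZ-\nabla^0_{[X,Y]}Z$. Its Ricci tensor is $$\mathrm{Ric}^0(X,Y)=-g(R^0(X,e_1)Y,e_1)-g(R^0(X,e_2)Y,e_2)+g(R^0(X,e_3)Y,e_3),$$ and its symmetrization is $\widetilde{\mathrm{Ric}}^0(X,Y)=\frac12\big(\mathrm{Ric}^0(X,Y)+\mathrm{Ric}^0(Y,X)\big)$. For a left-invariant vector field $\xi=\lambda_1e_1+\lambda_2e_2+\lambda_3e_3$ ($\lambda_i\in\mathbb{R}$), $$(L_\xi\widetilde{\mathrm{Ric}}^0)(X,Y)=\xi\big(\widetilde{\mathrm{Ric}}^0(X,Y)\big)-\widetilde{\mathrm{Ric}}^0([\xi,X],Y)-\widetilde{\mathrm{Ric}}^0(X,[\xi,Y]).$$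 A left-invariant Ricci collineation associated to $\nabla^0$ is a left-invariant $\xi$ with $L_\xi\widetilde{\mathrm{Ric}}^0=0$; $\mathbb{V}_{\mathbb{RC}}$ denotes the real vector space of all of them, and $\langle\cdot\rangle$ denotes linear span. The group admits left-invariant Ricci collineations if there is a nonzero such $\xi$. *)

theory Defs
  imports
    "HOL-Analysis.Analysis"
    "HOL-Algebra.Group"
    "HOL-Library.Function_Algebras"
begin

section \<open>Pointwise real vector space structure on function types\<close>

instantiation "fun" :: (type, real_vector) real_vector
begin

definition scaleR_fun_def: "c *\<^sub>R f = (\<lambda>x. c *\<^sub>R f x)"

instance
  by standard (simp_all add: scaleR_fun_def fun_eq_iff scaleR_add_left scaleR_add_right)

end

lemma scaleR_fun_apply [simp]: "(c *\<^sub>R f) x = c *\<^sub>R f x"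
  by (simp add: scaleR_fun_def)

section \<open>Smooth manifolds\<close>

text \<open>
  The predicates below are meant for open \<open>S\<close>. By finite dimensionality of the domain, all
  directional derivatives being \<open>C\<^sup>k\<close> is the same as the derivative being \<open>C\<^sup>k\<close>.
\<close>

fun Ck_on :: "nat \<Rightarrow> 'e::euclidean_space set \<Rightarrow> ('e \<Rightarrow> 'b::real_normed_vector) \<Rightarrow> bool" where
  "Ck_on 0 S f \<longleftrightarrow> continuous_on S f"
| "Ck_on (Suc k) S f \<longleftrightarrow>
     (\<forall>x\<in>S. f differentiable (at x)) \<and>
     (\<forall>v. Ck_on k S (\<lambda>x. frechet_derivative f (at x) v))"

definition smooth_on :: "'e::euclidean_space set \<Rightarrow> ('e \<Rightarrow> 'b::real_normed_vector) \<Rightarrow> bool" where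
  "smooth_on S f \<longleftrightarrow> (\<forall>k. Ck_on k S f)"

type_synonym ('p, 'e) chart = "'p set \<times> ('p \<Rightarrow> 'e)"

definition smooth_atlas :: "('p::topological_space, 'e::euclidean_space) chart set \<Rightarrow> bool" where
  "smooth_atlas A \<longleftrightarrow>
     (\<forall>(U, \<phi>) \<in> A. open U \<and> open (\<phi> ` U) \<and> (\<exists>\<psi>. homeomorphism U (\<phi> ` U) \<phi> \<psi>)) \<and>
     (\<Union>(U, \<phi>) \<in> A. U) = UNIV \<and>
     (\<forall>(U, \<phi>) \<in> A. \<forall>(V, \<theta>) \<in> A. smooth_on (\<phi> ` (U \<inter> V)) (\<theta> \<circ> inv_into U \<phi>))"

definition prod_atlas ::
  "('p, 'e) chart set \<Rightarrow> ('q, 'f) chart set \<Rightarrow> ('p \<times> 'q, 'e \<times> 'f) chart set" where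
  "prod_atlas A B = {(U \<times> V, map_prod \<phi> \<theta>) | U \<phi> V \<theta>. (U, \<phi>) \<in> A \<and> (V, \<theta>) \<in> B}"

definition smooth_map ::
  "('p::topological_space, 'e::euclidean_space) chart set \<Rightarrow>
   ('q::topological_space, 'f::euclidean_space) chart set \<Rightarrow> ('p \<Rightarrow> 'q) \<Rightarrow> bool" where
  "smooth_map A B h \<longleftrightarrow> continuous_on UNIV h \<and>
     (\<forall>(U, \<phi>) \<in> A. \<forall>(V, \<theta>) \<in> B. smooth_on (\<phi> ` (U \<inter> h -` V)) (\<theta> \<circ> h \<circ> inv_into U \<phi>))"

definition C_inf :: "('p, 'e::euclidean_space) chart set \<Rightarrow> ('p \<Rightarrow> real) set" where
  "C_inf A = {f. \<forall>(U, \<phi>) \<in> A. smooth_on (\<phi> ` U) (f \<circ> inv_into U \<phi>)}"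

section \<open>Tangent vectors and vector fields\<close>

text \<open>
  A tangent vector at \<open>p\<close> is a directional derivative in a chart around \<open>p\<close>, as a functional on the
  smooth functions. Functionals are total in HOL and are normalised to \<open>0\<close> on non-smooth functions.
\<close>

type_synonym 'p tangent_vector = "('p \<Rightarrow> real) \<Rightarrow> real"

definition tangent_space ::
  "('p, 'e::euclidean_space) chart set \<Rightarrow> 'p \<Rightarrow> 'p tangent_vector set" where
  "tangent_space A p =
     {(\<lambda>f. if f \<in> C_inf A then frechet_derivative (f \<circ> inv_into U \<phi>) (at (\<phi> p)) w else 0) |
       U \<phi> w. (U, \<phi>) \<in> A \<and> p \<in> U}"

text \<open>The differential of a smooth self-map \<open>h\<close>; it maps vectors at \<open>p\<close> to vectors at \<open>h p\<close>.\<close>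

definition pushforward ::
  "('p, 'e::euclidean_space) chart set \<Rightarrow> ('p \<Rightarrow> 'p) \<Rightarrow> 'p tangent_vector \<Rightarrow> 'p tangent_vector" where
  "pushforward A h u = (\<lambda>f. if f \<in> C_inf A then u (f \<circ> h) else 0)"

type_synonym 'p vector_field = "'p \<Rightarrow> 'p tangent_vector"

definition vector_fields :: "('p, 'e::euclidean_space) chart set \<Rightarrow> 'p vector_field set" where
  "vector_fields A =
     {X. (\<forall>p. X p \<in> tangent_space A p) \<and> (\<forall>f \<in> C_inf A. (\<lambda>p. X p f) \<in> C_inf A)}"

definition lie_bracket :: "'p vector_field \<Rightarrow> 'p vector_field \<Rightarrow> 'p vector_field" where
  "lie_bracket X Y = (\<lambda>p f. X p (\<lambda>q. Y q f) - Y p (\<lambda>q. X q f))"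

definition fun_scale :: "('p \<Rightarrow> real) \<Rightarrow> 'p vector_field \<Rightarrow> 'p vector_field" where
  "fun_scale h X = (\<lambda>p. h p *\<^sub>R X p)"

section \<open>Tensor fields and connections\<close>

text \<open>Bilinear forms and endomorphisms are given pointwise on the tangent spaces.\<close>

type_synonym 'p form_field = "'p \<Rightarrow> 'p tangent_vector \<Rightarrow> 'p tangent_vector \<Rightarrow> real"
type_synonym 'p endo_field = "'p \<Rightarrow> 'p tangent_vector \<Rightarrow> 'p tangent_vector"

definition form_app ::
  "'p form_field \<Rightarrow> 'p vector_field \<Rightarrow> 'p vector_field \<Rightarrow> 'p \<Rightarrow> real" where
  "form_app g X Y = (\<lambda>p. g p (X p) (Y p))"

definition endo_app :: "'p endo_field \<Rightarrow> 'p vector_field \<Rightarrow> 'p vector_field" where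
  "endo_app J X = (\<lambda>p. J p (X p))"

text \<open>
  The last clause says that every \<open>g p\<close> is nondegenerate of index 1: there is a timelike vector on
  whose orthogonal complement \<open>g p\<close> is positive definite.
\<close>

definition lorentzian_metric ::
  "('p, 'e::euclidean_space) chart set \<Rightarrow> 'p form_field \<Rightarrow> bool" where
  "lorentzian_metric A g \<longleftrightarrow>
     (\<forall>p. \<forall>u \<in> tangent_space A p. \<forall>v \<in> tangent_space A p. g p u v = g p v u) \<and>
     (\<forall>p. \<forall>u \<in> tangent_space A p. \<forall>v \<in> tangent_space A p. \<forall>w \<in> tangent_space A p. \<forall>c.
        g p (c *\<^sub>R u + v) w = c * g p u w + g p v w) \<and>
     (\<forall>X \<in> vector_fields A. \<forall>Y \<in> vector_fields A. form_app g X Y \<in> C_inf A) \<and>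
     (\<forall>p. \<exists>t \<in> tangent_space A p. g p t t < 0 \<and>
        (\<forall>v \<in> tangent_space A p. g p t v = 0 \<and> v \<noteq> 0 \<longrightarrow> g p v v > 0))"

definition product_structure ::
  "('p, 'e::euclidean_space) chart set \<Rightarrow> 'p endo_field \<Rightarrow> bool" where
  "product_structure A J \<longleftrightarrow>
     (\<forall>p. \<forall>u \<in> tangent_space A p. J p u \<in> tangent_space A p \<and> J p (J p u) = u) \<and>
     (\<forall>p. \<forall>u \<in> tangent_space A p. \<forall>v \<in> tangent_space A p. \<forall>c.
        J p (c *\<^sub>R u + v) = c *\<^sub>R J p u + J p v) \<and>
     (\<forall>X \<in> vector_fields A. endo_app J X \<in> vector_fields A)"

type_synonym 'p connection = "'p vector_field \<Rightarrow> 'p vector_field \<Rightarrow> 'p vector_field"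

definition affine_connection ::
  "('p, 'e::euclidean_space) chart set \<Rightarrow> 'p connection \<Rightarrow> bool" where
  "affine_connection A D \<longleftrightarrow>
     (\<forall>X \<in> vector_fields A. \<forall>Y \<in> vector_fields A. D X Y \<in> vector_fields A) \<and>
     (\<forall>X \<in> vector_fields A. \<forall>Y \<in> vector_fields A. \<forall>Z \<in> vector_fields A.
        D (X + Y) Z = D X Z + D Y Z \<and> D X (Y + Z) = D X Y + D X Z) \<and>
     (\<forall>h \<in> C_inf A. \<forall>X \<in> vector_fields A. \<forall>Y \<in> vector_fields A.
        D (fun_scale h X) Y = fun_scale h (D X Y) \<and>
        D X (fun_scale h Y) = fun_scale (\<lambda>p. X p h) Y + fun_scale h (D X Y))"

definition levi_civita ::
  "('p, 'e::euclidean_space) chart set \<Rightarrow> 'p form_field \<Rightarrow> 'p connection \<Rightarrow> bool" where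
  "levi_civita A g D \<longleftrightarrow> affine_connection A D \<and>
     (\<forall>X \<in> vector_fields A. \<forall>Y \<in> vector_fields A. D X Y - D Y X = lie_bracket X Y) \<and>
     (\<forall>X \<in> vector_fields A. \<forall>Y \<in> vector_fields A. \<forall>Z \<in> vector_fields A. \<forall>p.
        X p (form_app g Y Z) = form_app g (D X Y) Z p + form_app g Y (D X Z) p)"

definition cov_deriv_endo ::
  "'p connection \<Rightarrow> 'p endo_field \<Rightarrow> 'p vector_field \<Rightarrow> 'p vector_field \<Rightarrow> 'p vector_field" where
  "cov_deriv_endo D J X Z = D X (endo_app J Z) - endo_app J (D X Z)"

definition canonical_connection :: "'p connection \<Rightarrow> 'p endo_field \<Rightarrow> 'p connection" where
  "canonical_connection D J X Y = D X Y - (1/2) *\<^sub>R cov_deriv_endo D J X (endo_app J Y)"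

definition curvature ::
  "'p connection \<Rightarrow> 'p vector_field \<Rightarrow> 'p vector_field \<Rightarrow> 'p vector_field \<Rightarrow> 'p vector_field" where
  "curvature D X Y Z = D X (D Y Z) - D Y (D X Z) - D (lie_bracket X Y) Z"

type_synonym 'p form_on_fields = "'p vector_field \<Rightarrow> 'p vector_field \<Rightarrow> 'p \<Rightarrow> real"

text \<open>Ricci tensor of \<open>D\<close>, for a pseudo-orthonormal frame whose third member is timelike.\<close>

definition ricci ::
  "'p form_field \<Rightarrow> 'p vector_field \<Rightarrow> 'p vector_field \<Rightarrow> 'p vector_field \<Rightarrow>
   'p connection \<Rightarrow> 'p form_on_fields" where
  "ricci g e1 e2 e3 D X Y =
     - form_app g (curvature D X e1 Y) e1
     - form_app g (curvature D X e2 Y) e2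
     + form_app g (curvature D X e3 Y) e3"

definition symmetrization :: "'p form_on_fields \<Rightarrow> 'p form_on_fields" where
  "symmetrization T X Y = (1/2) *\<^sub>R (T X Y + T Y X)"

definition lie_derivative_form :: "'p vector_field \<Rightarrow> 'p form_on_fields \<Rightarrow> 'p form_on_fields" where
  "lie_derivative_form \<xi> T X Y =
     (\<lambda>p. \<xi> p (T X Y) - T (lie_bracket \<xi> X) Y p - T X (lie_bracket \<xi> Y) p)"

section \<open>Lie groups and left invariance\<close>

text \<open>
  The underlying set of the group is a whole type, so that it carries the topology of that type.
\<close>

definition lie_group ::
  "('p::{t2_space, second_countable_topology}) monoid \<Rightarrow> ('p, 'e::euclidean_space) chart set \<Rightarrow> bool"
  where
  "lie_group G A \<longleftrightarrow> group G \<and> carrier G = UNIV \<and> smooth_atlas A \<and>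
     smooth_map (prod_atlas A A) A (\<lambda>(x, y). x \<otimes>\<^bsub>G\<^esub> y) \<and>
     smooth_map A A (\<lambda>x. inv\<^bsub>G\<^esub> x)"

definition left_differential ::
  "'p monoid \<Rightarrow> ('p, 'e::euclidean_space) chart set \<Rightarrow> 'p \<Rightarrow> 'p tangent_vector \<Rightarrow> 'p tangent_vector"
  where
  "left_differential G A a = pushforward A (\<lambda>x. a \<otimes>\<^bsub>G\<^esub> x)"

definition left_invariant_fields ::
  "'p monoid \<Rightarrow> ('p, 'e::euclidean_space) chart set \<Rightarrow> 'p vector_field set" where
  "left_invariant_fields G A =
     {X \<in> vector_fields A. \<forall>a p. X (a \<otimes>\<^bsub>G\<^esub> p) = left_differential G A a (X p)}"

definition left_invariant_form ::
  "'p monoid \<Rightarrow> ('p, 'e::euclidean_space) chart set \<Rightarrow> 'p form_field \<Rightarrow> bool" where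
  "left_invariant_form G A g \<longleftrightarrow>
     (\<forall>a p. \<forall>u \<in> tangent_space A p. \<forall>v \<in> tangent_space A p.
        g (a \<otimes>\<^bsub>G\<^esub> p) (left_differential G A a u) (left_differential G A a v) = g p u v)"

definition left_invariant_endo ::
  "'p monoid \<Rightarrow> ('p, 'e::euclidean_space) chart set \<Rightarrow> 'p endo_field \<Rightarrow> bool" where
  "left_invariant_endo G A J \<longleftrightarrow>
     (\<forall>a p. \<forall>u \<in> tangent_space A p.
        J (a \<otimes>\<^bsub>G\<^esub> p) (left_differential G A a u) = left_differential G A a (J p u))"

text \<open>A basis of the Lie algebra of left-invariant fields, pseudo-orthonormal with \<open>e3\<close> timelike.\<close>

definition pseudo_orthonormal_basis ::
  "'p monoid \<Rightarrow> ('p, 'e::euclidean_space) chart set \<Rightarrow> 'p form_field \<Rightarrow>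
   'p vector_field \<Rightarrow> 'p vector_field \<Rightarrow> 'p vector_field \<Rightarrow> bool" where
  "pseudo_orthonormal_basis G A g e1 e2 e3 \<longleftrightarrow>
     independent {e1, e2, e3} \<and> span {e1, e2, e3} = left_invariant_fields G A \<and>
     (\<forall>p. form_app g e1 e1 p = 1 \<and> form_app g e2 e2 p = 1 \<and> form_app g e3 e3 p = -1 \<and>
          form_app g e1 e2 p = 0 \<and> form_app g e1 e3 p = 0 \<and> form_app g e2 e3 p = 0)"

text \<open>
  The left-invariant Ricci collineations associated to the canonical connection; \<open>D\<close> is the
  Levi-Civita connection of \<open>g\<close>. The Lie derivative has to vanish on all smooth vector fields,
  not only on left-invariant ones.
\<close>

definition ricci_collineations ::
  "'p monoid \<Rightarrow> ('p, 'e::euclidean_space) chart set \<Rightarrow> 'p form_field \<Rightarrow> 'p endo_field \<Rightarrow>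
   'p connection \<Rightarrow> 'p vector_field \<Rightarrow> 'p vector_field \<Rightarrow> 'p vector_field \<Rightarrow>
   'p vector_field set" where
  "ricci_collineations G A g J D e1 e2 e3 =
     {\<xi> \<in> left_invariant_fields G A. \<forall>X \<in> vector_fields A. \<forall>Y \<in> vector_fields A.
        lie_derivative_form \<xi>
          (symmetrization (ricci g e1 e2 e3 (canonical_connection D J))) X Y = 0}"

end

theory Submission
  imports Defs
begin

text \<open>
  Since \<open>J\<close> is parallel for \<open>\<nabla>\<^sup>0\<close>, and \<open>\<nabla>\<^sup>0\<close> is the average of \<open>\<nabla>\<close> and its \<open>J\<close>-conjugate, \<open>\<nabla>\<^sup>0\<close> is
  governed by the single one-form \<open>\<omega>(X) = g(\<nabla>\<^sub>Xe\<^sub>1, e\<^sub>2)\<close>: \<open>\<nabla>\<^sup>0\<^sub>Xe\<^sub>1 = \<omega>(X)e\<^sub>2\<close>,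
  \<open>\<nabla>\<^sup>0\<^sub>Xe\<^sub>2 = -\<omega>(X)e\<^sub>1\<close> and \<open>\<nabla>\<^sup>0\<^sub>Xe\<^sub>3 = 0\<close>. Its curvature is read off \<open>d\<omega>\<close>, and the symmetrized
  Ricci tensor has only the components \<open>r\<^sub>1\<^sub>1 = r\<^sub>2\<^sub>2\<close> and \<open>r\<^sub>2\<^sub>3\<close>. The tangent spaces are spanned by
  the frame and the Lie derivative is a tensor, so its vanishing on all vector fields is a linear
  system for the coefficients of \<open>\<xi>\<close>. As \<open>\<alpha>\<gamma> = \<beta>\<delta>\<close>, \<open>r\<^sub>2\<^sub>3 = -\<gamma>(\<alpha> + \<delta>)/4\<close> vanishes only for
  \<open>\<gamma> = 0\<close>; if \<open>\<gamma> \<noteq> 0\<close>, the system has a nonzero solution exactly if \<open>\<alpha>\<delta> = \<beta>\<gamma>\<close>.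
\<close>

section \<open>Smooth functions\<close>

text \<open>Derivatives at a point of the open set \<open>S\<close> depend only on values near that
  point, all of them taken in \<open>S\<close>. As a congruence rule this replaces a derivative by a
  formula that is valid on \<open>S\<close> alone.\<close>

lemma Ck_on_cong:
  assumes "open S" "\<And>x. x \<in> S \<Longrightarrow> f x = h x"
  shows "Ck_on k S f \<longleftrightarrow> Ck_on k S h"
  using assms(2)
proof (induction k arbitrary: f h)
  case 0
  then show ?case by (simp cong: continuous_on_cong)
next
  case (Suc k)
  have fh: "(f has_derivative f') (at x) \<longleftrightarrow> (h has_derivative f') (at x)" if "x \<in> S" for x f'
    using has_derivative_transform_within_open[OF _ assms(1) that] Suc.prems by metis
  have "frechet_derivative f (at x) = frechet_derivative h (at x)" if "x \<in> S" for x
    using fh[OF that] by (simp add: frechet_derivative_def)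
  then have "Ck_on k S (\<lambda>x. frechet_derivative f (at x) v)
      \<longleftrightarrow> Ck_on k S (\<lambda>x. frechet_derivative h (at x) v)" for v
    by (intro Suc.IH) simp
  then show ?case using fh by (simp add: differentiable_def)
qed

lemma Ck_on_Suc_imp: "Ck_on (Suc k) S f \<Longrightarrow> Ck_on k S f"
proof (induction k arbitrary: f)
  case 0
  then show ?case
    by (simp add: differentiable_at_withinI differentiable_imp_continuous_on differentiable_on_def)
next
  case (Suc k)
  then show ?case using Suc.IH by (metis Ck_on.simps(2))
qed

lemma Ck_on_const: "Ck_on k S (\<lambda>x. c)"
  by (induction k arbitrary: c) simp_all

lemma Ck_on_add:
  assumes "open S" "Ck_on k S f" "Ck_on k S h"
  shows "Ck_on k S (\<lambda>x. f x + h x)"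
  using assms(2,3)
proof (induction k arbitrary: f h)
  case 0
  then show ?case by (simp add: continuous_on_add)
next
  case (Suc k)
  have "frechet_derivative (\<lambda>x. f x + h x) (at x)
      = (\<lambda>v. frechet_derivative f (at x) v + frechet_derivative h (at x) v)" if "x \<in> S" for x
    using Suc.prems that
    by (intro frechet_derivative_at[symmetric] has_derivative_add)
      (auto simp: frechet_derivative_works)
  then have "Ck_on k S (\<lambda>x. frechet_derivative (\<lambda>x. f x + h x) (at x) v)" for v
    using Suc by (simp cong: Ck_on_cong[OF assms(1)])
  with Suc.prems show ?case by simp
qed

lemma Ck_on_mult:
  fixes f h :: "'e::euclidean_space \<Rightarrow> real"
  assumes "open S" "Ck_on k S f" "Ck_on k S h"
  shows "Ck_on k S (\<lambda>x. f x * h x)"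
  using assms(2,3)
proof (induction k arbitrary: f h)
  case 0
  then show ?case by (simp add: continuous_on_mult)
next
  case (Suc k)
  have "frechet_derivative (\<lambda>x. f x * h x) (at x)
      = (\<lambda>v. f x * frechet_derivative h (at x) v + frechet_derivative f (at x) v * h x)"
    if "x \<in> S" for x
    using Suc.prems that
    by (intro frechet_derivative_at[symmetric] has_derivative_mult)
      (auto simp: frechet_derivative_works)
  \<comment> \<open>The product rule keeps undifferentiated factors, so the hypotheses of order
    \<open>Suc k\<close> are also needed at order \<open>k\<close>.\<close>
  moreover have "Ck_on k S f" "Ck_on k S h"
    using Suc.prems Ck_on_Suc_imp by blast+
  ultimately have "Ck_on k S (\<lambda>x. frechet_derivative (\<lambda>x. f x * h x) (at x) v)" for v
    using Suc by (simp add: Ck_on_add[OF assms(1)] cong: Ck_on_cong[OF assms(1)])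
  with Suc.prems show ?case by simp
qed

section \<open>Charts and smooth functions on a manifold\<close>

locale smooth_manifold =
  fixes A :: "('p::topological_space, 'e::euclidean_space) chart set"
  assumes atlas: "smooth_atlas A"
begin

text \<open>A chart is a homeomorphism onto an open set, hence an open map into the model space. The
  last fact makes the images of chart overlaps open, as differentiation there requires.\<close>

lemma chartD:
  assumes "(U, \<phi>) \<in> A"
  shows "open U" "open (\<phi> ` U)" "inj_on \<phi> U"
    "\<And>W. open W \<Longrightarrow> open (\<phi> ` (U \<inter> W))"
proof -
  obtain \<psi> where *: "open U" "open (\<phi> ` U)" "homeomorphism U (\<phi> ` U) \<phi> \<psi>"
    using atlas assms unfolding smooth_atlas_def by blast
  then show "open U" "open (\<phi> ` U)" "inj_on \<phi> U"
    by (auto intro: inj_on_inverseI[where g=\<psi>] simp: homeomorphism_apply1)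
  fix W :: "'p set" assume "open W"
  then have "openin (top_of_set (\<phi> ` U)) (\<phi> ` (U \<inter> W))"
    by (intro homeomorphism_imp_open_map[OF *(3)]) auto
  with *(2) show "open (\<phi> ` (U \<inter> W))" by (simp add: openin_open_eq)
qed

lemma chart_at: obtains U \<phi> where "(U, \<phi>) \<in> A" "p \<in> U"
  using atlas unfolding smooth_atlas_def by blast

lemma C_inf_const: "(\<lambda>_. c) \<in> C_inf A"
  by (auto simp: C_inf_def smooth_on_def o_def Ck_on_const)

lemma C_inf_add: "f \<in> C_inf A \<Longrightarrow> h \<in> C_inf A \<Longrightarrow> f + h \<in> C_inf A"
  by (fastforce simp: C_inf_def smooth_on_def o_def intro!: Ck_on_add chartD)

lemma C_inf_mult: "f \<in> C_inf A \<Longrightarrow> h \<in> C_inf A \<Longrightarrow> f * h \<in> C_inf A"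
  by (fastforce simp: C_inf_def smooth_on_def o_def intro!: Ck_on_mult chartD)

lemma C_inf_scaleR: "f \<in> C_inf A \<Longrightarrow> c *\<^sub>R f \<in> C_inf A"
  using C_inf_mult[OF C_inf_const[of c]] by (simp add: times_fun_def scaleR_fun_def)

lemma C_inf_uminus: "f \<in> C_inf A \<Longrightarrow> - f \<in> C_inf A"
  using C_inf_scaleR[of f "-1"] by simp

lemma C_inf_diff: "f \<in> C_inf A \<Longrightarrow> h \<in> C_inf A \<Longrightarrow> f - h \<in> C_inf A"
  using C_inf_add[OF _ C_inf_uminus] by fastforce

lemma C_inf_differentiable:
  assumes "f \<in> C_inf A" "(U, \<phi>) \<in> A" "p \<in> U"
  shows "(f \<circ> inv_into U \<phi>) differentiable (at (\<phi> p))"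
proof -
  have "Ck_on (Suc 0) (\<phi> ` U) (f \<circ> inv_into U \<phi>)"
    using assms(1,2) unfolding C_inf_def smooth_on_def by blast
  with assms(3) show ?thesis by simp
qed

section \<open>Tangent vectors\<close>

text \<open>The functionals collected in \<open>tangent_space\<close>, with the chart fixed: as a
  function of the direction \<open>w\<close> this is a linear map from the model space, whose range
  turns out to be the whole tangent space.\<close>

definition chart_vector :: "'p set \<Rightarrow> ('p \<Rightarrow> 'e) \<Rightarrow> 'p \<Rightarrow> 'e \<Rightarrow> 'p tangent_vector" where
  "chart_vector U \<phi> p w =
     (\<lambda>f. if f \<in> C_inf A then frechet_derivative (f \<circ> inv_into U \<phi>) (at (\<phi> p)) w else 0)"

lemma linear_chart_vector:
  assumes "(U, \<phi>) \<in> A" "p \<in> U"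
  shows "linear (chart_vector U \<phi> p)"
proof -
  have "linear (frechet_derivative (f \<circ> inv_into U \<phi>) (at (\<phi> p)))" if "f \<in> C_inf A" for f
    using C_inf_differentiable[OF that assms] by (rule linear_frechet_derivative)
  then show ?thesis
    by (intro linearI) (auto simp: chart_vector_def fun_eq_iff linear_add linear_scale)
qed

text \<open>Chain rule: near \<open>p\<close> the expression of \<open>f\<close> in the first chart
  is the one in the second chart after the transition map \<open>?t\<close>. The derivative of
  \<open>?t\<close> carries \<open>w\<close> to the new direction.\<close>

lemma chart_vector_change:
  assumes U: "(U, \<phi>) \<in> A" "p \<in> U" and V: "(V, \<theta>) \<in> A" "p \<in> V"
  shows "\<exists>w'. chart_vector U \<phi> p w = chart_vector V \<theta> p w'"
proof -
  let ?t = "\<theta> \<circ> inv_into U \<phi>"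
  let ?S = "\<phi> ` (U \<inter> V)"
  have inv: "inv_into U \<phi> (\<phi> q) = q" if "q \<in> U" for q
    using chartD(3)[OF U(1)] that by simp
  have invV: "inv_into V \<theta> (\<theta> q) = q" if "q \<in> V" for q
    using chartD(3)[OF V(1)] that by simp
  have S: "open ?S" "\<phi> p \<in> ?S"
    using chartD(4)[OF U(1)] chartD(1)[OF V(1)] U V by auto
  have "smooth_on ?S ?t"
    using atlas U(1) V(1) unfolding smooth_atlas_def by blast
  then have "Ck_on (Suc 0) ?S ?t" unfolding smooth_on_def by blast
  with S(2) have t: "?t differentiable (at (\<phi> p))" unfolding Ck_on.simps by blast
  have "frechet_derivative (f \<circ> inv_into U \<phi>) (at (\<phi> p)) w
      = frechet_derivative (f \<circ> inv_into V \<theta>) (at (\<theta> p)) (frechet_derivative ?t (at (\<phi> p)) w)"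
    if f: "f \<in> C_inf A" for f
  proof -
    have tp: "?t (\<phi> p) = \<theta> p" using inv[OF U(2)] by simp
    have "((f \<circ> inv_into V \<theta>) \<circ> ?t has_derivative
        frechet_derivative (f \<circ> inv_into V \<theta>) (at (\<theta> p)) \<circ> frechet_derivative ?t (at (\<phi> p)))
        (at (\<phi> p))"
      using t C_inf_differentiable[OF f V] tp
      by (intro diff_chain_at) (simp_all add: frechet_derivative_works)
    then have "(f \<circ> inv_into U \<phi> has_derivative
        frechet_derivative (f \<circ> inv_into V \<theta>) (at (\<theta> p)) \<circ> frechet_derivative ?t (at (\<phi> p)))
        (at (\<phi> p))"
      \<comment> \<open>The two local expressions agree only on the image \<open>?S\<close> of the
        overlap, which suffices because it is open.\<close>
      by (rule has_derivative_transform_within_open[OF _ S]) (auto simp: inv invV)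
    from frechet_derivative_at[OF this] show ?thesis by (metis comp_apply)
  qed
  then show ?thesis by (auto simp: chart_vector_def fun_eq_iff)
qed

text \<open>The definition collects directions from all charts around \<open>p\<close>. Every
  direction can be moved into one chosen chart, which exhibits the tangent space as the image of a
  linear map.\<close>

lemma tangent_space_eq_range:
  assumes "(U, \<phi>) \<in> A" "p \<in> U"
  shows "tangent_space A p = range (chart_vector U \<phi> p)"
proof -
  have "tangent_space A p = (\<Union>(V, \<theta>) \<in> {(V, \<theta>) \<in> A. p \<in> V}. range (chart_vector V \<theta> p))"
    unfolding tangent_space_def chart_vector_def by blast
  also have "\<dots> = range (chart_vector U \<phi> p)"
    using chart_vector_change assms by (fastforce simp: image_iff)
  finally show ?thesis .
qed

lemma tangent_space_subspace: "subspace (tangent_space A p)"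
  by (metis chart_at linear_chart_vector linear_subspace_image subspace_UNIV tangent_space_eq_range)

text \<open>Dimension count: the tangent space is a linear image of the model space.\<close>

lemma tangent_space_span:
  assumes "B \<subseteq> tangent_space A p" "independent B" "card B = DIM('e)"
  shows "tangent_space A p = span B"
proof -
  obtain U \<phi> where U: "(U, \<phi>) \<in> A" "p \<in> U" by (rule chart_at)
  let ?L = "chart_vector U \<phi> p"
  have L: "linear ?L" using U by (rule linear_chart_vector)
  \<comment> \<open>One preimage is chosen for each member of \<open>B\<close>. A linear relation in
    \<open>C\<close> would be mapped to one in \<open>B\<close>, so \<open>C\<close> is independent
    and, by its size, spans the model space.\<close>
  obtain C where C: "inj_on ?L C" "?L ` C = B"
    using assms(1) subset_image_inj[of B ?L UNIV] by (auto simp: tangent_space_eq_range[OF U])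
  have "independent C"
    unfolding dependent_def
  proof safe
    fix a assume a: "a \<in> C" "a \<in> span (C - {a})"
    then have "?L a \<in> span (?L ` (C - {a}))"
      by (simp add: linear_span_image[OF L])
    also have "?L ` (C - {a}) = B - {?L a}"
      using C a(1) by (auto simp: inj_on_def)
    finally show False using assms(2) C(2) a(1) by (auto simp: dependent_def)
  qed
  moreover have "card C = DIM('e)" using C assms(3) card_image by fastforce
  ultimately have "span C = UNIV"
    by (metis dim_eq_card_independent dim_eq_full)
  then show ?thesis using C(2) linear_span_image[OF L, of C] tangent_space_eq_range[OF U] by auto
qed

section \<open>Tangent vectors as derivations\<close>

context
  fixes u p assumes u: "u \<in> tangent_space A p"
begin

lemma tangent_vector_const: "u (\<lambda>_. c) = 0"
  using u by (auto simp: tangent_space_def o_def)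

lemma tangent_vector_not_smooth: "f \<notin> C_inf A \<Longrightarrow> u f = 0"
  using u by (auto simp: tangent_space_def)

text \<open>Additivity is a matter of smooth functions: two non-smooth functions, both sent to 0,
  may have a smooth sum with nonzero derivative.\<close>

lemma tangent_vector_add:
  assumes "f \<in> C_inf A" "h \<in> C_inf A"
  shows "u (f + h) = u f + u h"
proof -
  obtain U \<phi> w where U: "(U, \<phi>) \<in> A" "p \<in> U" and w: "u = chart_vector U \<phi> p w"
    using u unfolding tangent_space_def chart_vector_def by blast
  have "frechet_derivative ((f + h) \<circ> inv_into U \<phi>) (at (\<phi> p))
     = (\<lambda>v. frechet_derivative (f \<circ> inv_into U \<phi>) (at (\<phi> p)) v
          + frechet_derivative (h \<circ> inv_into U \<phi>) (at (\<phi> p)) v)"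
    unfolding plus_fun_def o_def
    using C_inf_differentiable[OF assms(1) U] C_inf_differentiable[OF assms(2) U]
    by (intro frechet_derivative_at[symmetric] has_derivative_add)
      (simp_all add: frechet_derivative_works o_def)
  with assms C_inf_add[OF assms] show ?thesis by (simp add: w chart_vector_def)
qed

lemma tangent_vector_mult:
  assumes "f \<in> C_inf A" "h \<in> C_inf A"
  shows "u (f * h) = u f * h p + f p * u h"
proof -
  obtain U \<phi> w where U: "(U, \<phi>) \<in> A" "p \<in> U" and w: "u = chart_vector U \<phi> p w"
    using u unfolding tangent_space_def chart_vector_def by blast
  have "frechet_derivative ((f * h) \<circ> inv_into U \<phi>) (at (\<phi> p))
     = (\<lambda>v. (f \<circ> inv_into U \<phi>) (\<phi> p) * frechet_derivative (h \<circ> inv_into U \<phi>) (at (\<phi> p)) v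
          + frechet_derivative (f \<circ> inv_into U \<phi>) (at (\<phi> p)) v * (h \<circ> inv_into U \<phi>) (\<phi> p))"
    unfolding times_fun_def o_def
    using C_inf_differentiable[OF assms(1) U] C_inf_differentiable[OF assms(2) U]
    by (intro frechet_derivative_at[symmetric] has_derivative_mult)
      (simp_all add: frechet_derivative_works o_def)
  with assms C_inf_mult[OF assms] chartD(3)[OF U(1)] U(2) show ?thesis
    by (simp add: w chart_vector_def)
qed

end

end

section \<open>Vector fields and tensors\<close>

context smooth_manifold
begin

lemma vector_field_tangent: "X \<in> vector_fields A \<Longrightarrow> X p \<in> tangent_space A p"
  by (simp add: vector_fields_def)

lemma vector_field_not_smooth: "X \<in> vector_fields A \<Longrightarrow> f \<notin> C_inf A \<Longrightarrow> X p f = 0"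
  using tangent_vector_not_smooth vector_field_tangent by blast

text \<open>No hypothesis on \<open>f\<close>: tangent vectors vanish on functions that are not smooth.\<close>

lemma vector_field_smooth: "X \<in> vector_fields A \<Longrightarrow> (\<lambda>p. X p f) \<in> C_inf A"
  using vector_field_not_smooth[of X f] C_inf_const[of 0]
  by (cases "f \<in> C_inf A") (auto simp: vector_fields_def)

lemma fun_scale_apply: "fun_scale h X p f = h p * X p f"
  by (simp add: fun_scale_def)

text \<open>Turns each rule for multiples by smooth functions into one for real multiples.\<close>

lemma fun_scale_const: "fun_scale (\<lambda>_. c) X = c *\<^sub>R X"
  by (simp add: fun_scale_def fun_eq_iff)

lemma vector_fields_add:
  assumes "X \<in> vector_fields A" "Y \<in> vector_fields A"
  shows "X + Y \<in> vector_fields A"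
  using assms C_inf_add[OF vector_field_smooth[OF assms(1)] vector_field_smooth[OF assms(2)]]
  by (auto simp: vector_fields_def plus_fun_def
      intro: subspace_add[OF tangent_space_subspace, unfolded plus_fun_def])

lemma vector_fields_fun_scale:
  assumes "h \<in> C_inf A" "X \<in> vector_fields A"
  shows "fun_scale h X \<in> vector_fields A"
proof -
  have "(\<lambda>p. fun_scale h X p f) \<in> C_inf A" for f
    using C_inf_mult[OF assms(1) vector_field_smooth[OF assms(2), of f]]
    by (simp add: fun_scale_apply times_fun_def)
  with assms show ?thesis
    by (auto simp: vector_fields_def fun_scale_def intro: subspace_scale[OF tangent_space_subspace])
qed

lemma vector_fields_scaleR: "X \<in> vector_fields A \<Longrightarrow> c *\<^sub>R X \<in> vector_fields A"
  using vector_fields_fun_scale[OF C_inf_const] by (simp add: fun_scale_const)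

lemma vector_fields_uminus: "X \<in> vector_fields A \<Longrightarrow> - X \<in> vector_fields A"
  using vector_fields_scaleR[of X "-1"] by simp

lemma vector_fields_diff:
  "X \<in> vector_fields A \<Longrightarrow> Y \<in> vector_fields A \<Longrightarrow> X - Y \<in> vector_fields A"
  using vector_fields_add[of X "- Y"] vector_fields_uminus[of Y] by simp

lemmas vector_fields_closed =
  vector_fields_add vector_fields_diff vector_fields_uminus vector_fields_scaleR
  vector_fields_fun_scale

lemma lie_bracket_skew: "lie_bracket Y X = - lie_bracket X Y"
  by (simp add: lie_bracket_def fun_eq_iff)

text \<open>The inner functions, such as the map from \<open>q\<close> to \<open>Y q f\<close>, are
  smooth for every \<open>f\<close> by the normalisation of tangent vectors. The derivation rules
  for \<open>X p\<close> therefore give an equation of total functionals.\<close>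

lemma lie_bracket_add_right:
  assumes "X \<in> vector_fields A" "Y \<in> vector_fields A" "Z \<in> vector_fields A"
  shows "lie_bracket X (Y + Z) = lie_bracket X Y + lie_bracket X Z"
proof (intro ext)
  fix p f
  have "X p (\<lambda>q. Y q f + Z q f) = X p (\<lambda>q. Y q f) + X p (\<lambda>q. Z q f)"
    using tangent_vector_add[OF vector_field_tangent[OF assms(1)]
        vector_field_smooth[OF assms(2), of f] vector_field_smooth[OF assms(3), of f]]
    by (simp add: plus_fun_def)
  then show "lie_bracket X (Y + Z) p f = (lie_bracket X Y + lie_bracket X Z) p f"
    by (simp add: lie_bracket_def)
qed

lemma lie_bracket_fun_scale_right:
  assumes "X \<in> vector_fields A" "Y \<in> vector_fields A" "h \<in> C_inf A"
  shows "lie_bracket X (fun_scale h Y) = fun_scale (\<lambda>p. X p h) Y + fun_scale h (lie_bracket X Y)"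
proof (intro ext)
  fix p f
  have "X p (\<lambda>q. h q * Y q f) = X p h * Y p f + h p * X p (\<lambda>q. Y q f)"
    using tangent_vector_mult[OF vector_field_tangent[OF assms(1)]
        assms(3) vector_field_smooth[OF assms(2), of f]]
    by (simp add: times_fun_def)
  then show "lie_bracket X (fun_scale h Y) p f
      = (fun_scale (\<lambda>p. X p h) Y + fun_scale h (lie_bracket X Y)) p f"
    by (simp add: lie_bracket_def fun_scale_apply algebra_simps)
qed

lemma lie_bracket_add_left:
  assumes "X \<in> vector_fields A" "Y \<in> vector_fields A" "Z \<in> vector_fields A"
  shows "lie_bracket (X + Y) Z = lie_bracket X Z + lie_bracket Y Z"
  using lie_bracket_add_right[OF assms(3,1,2)] lie_bracket_skew[of _ Z] by simp

lemma lie_bracket_fun_scale_left: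
  assumes "X \<in> vector_fields A" "Y \<in> vector_fields A" "h \<in> C_inf A"
  shows "lie_bracket (fun_scale h X) Y = fun_scale h (lie_bracket X Y) - fun_scale (\<lambda>p. Y p h) X"
  using lie_bracket_fun_scale_right[OF assms(2,1,3)] lie_bracket_skew[of _ Y]
  by (simp add: fun_scale_def fun_eq_iff)

lemma lie_bracket_scaleR_left:
  assumes "X \<in> vector_fields A" "Y \<in> vector_fields A"
  shows "lie_bracket (c *\<^sub>R X) Y = c *\<^sub>R lie_bracket X Y"
  using lie_bracket_fun_scale_left[OF assms C_inf_const[of c]]
    tangent_vector_const[OF vector_field_tangent[OF assms(2)], of _ c]
  by (simp add: fun_scale_const)

section \<open>One-forms and bilinear forms as tensors\<close>

text \<open>Tensors are encoded by linearity over the smooth functions because \<open>ricci\<close>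
  and \<open>lie_derivative_form\<close> take fields, not tangent vectors, as arguments. This
  linearity is what later reduces identities to a global frame.\<close>

definition one_form :: "('p vector_field \<Rightarrow> 'p \<Rightarrow> real) \<Rightarrow> bool" where
  "one_form \<theta> \<longleftrightarrow>
     (\<forall>X \<in> vector_fields A. \<theta> X \<in> C_inf A) \<and>
     (\<forall>X \<in> vector_fields A. \<forall>Y \<in> vector_fields A. \<theta> (X + Y) = \<theta> X + \<theta> Y) \<and>
     (\<forall>h \<in> C_inf A. \<forall>X \<in> vector_fields A. \<theta> (fun_scale h X) = h * \<theta> X)"

lemma one_formD:
  assumes "one_form \<theta>"
  shows "X \<in> vector_fields A \<Longrightarrow> \<theta> X \<in> C_inf A"
    "X \<in> vector_fields A \<Longrightarrow> Y \<in> vector_fields A \<Longrightarrow> \<theta> (X + Y) = \<theta> X + \<theta> Y"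
    "h \<in> C_inf A \<Longrightarrow> X \<in> vector_fields A \<Longrightarrow> \<theta> (fun_scale h X) = h * \<theta> X"
  using assms unfolding one_form_def by blast+

lemma one_form_scaleR:
  "one_form \<theta> \<Longrightarrow> X \<in> vector_fields A \<Longrightarrow> \<theta> (c *\<^sub>R X) = c *\<^sub>R \<theta> X"
  using one_formD(3)[OF _ C_inf_const[of c], of \<theta> X]
  by (simp add: fun_scale_const times_fun_def scaleR_fun_def)

lemma one_form_uminus: "one_form \<theta> \<Longrightarrow> X \<in> vector_fields A \<Longrightarrow> \<theta> (- X) = - \<theta> X"
  using one_form_scaleR[of \<theta> X "-1"] by simp

lemma one_form_diff:
  "one_form \<theta> \<Longrightarrow> X \<in> vector_fields A \<Longrightarrow> Y \<in> vector_fields A \<Longrightarrow> \<theta> (X - Y) = \<theta> X - \<theta> Y"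
  using one_formD(2)[of \<theta> X "- Y"] by (simp add: one_form_uminus vector_fields_uminus fun_eq_iff)

lemmas one_form_linear = one_formD(2,3) one_form_scaleR one_form_uminus one_form_diff

lemma one_form_plus: "one_form \<theta> \<Longrightarrow> one_form \<eta> \<Longrightarrow> one_form (\<lambda>X. \<theta> X + \<eta> X)"
  by (simp add: one_form_def C_inf_add algebra_simps)

lemma one_form_scale: "one_form \<theta> \<Longrightarrow> one_form (\<lambda>X. c *\<^sub>R \<theta> X)"
  by (simp add: one_form_def C_inf_scaleR fun_eq_iff algebra_simps)

lemma one_form_minus: "one_form \<theta> \<Longrightarrow> one_form (\<lambda>X. - \<theta> X)"
  using one_form_scale[of \<theta> "-1"] by simp

definition bilinear_form :: "'p form_on_fields \<Rightarrow> bool" where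
  "bilinear_form T \<longleftrightarrow>
     (\<forall>X \<in> vector_fields A. one_form (T X) \<and> one_form (\<lambda>Y. T Y X))"

lemma bilinear_formD:
  assumes "bilinear_form T" "X \<in> vector_fields A"
  shows "one_form (T X)" "one_form (\<lambda>Y. T Y X)"
  using assms by (simp_all add: bilinear_form_def)

lemma bilinear_form_symmetrization:
  assumes "bilinear_form T"
  shows "bilinear_form (symmetrization T)"
  unfolding bilinear_form_def symmetrization_def
  by (intro ballI conjI one_form_scale one_form_plus bilinear_formD[OF assms])

text \<open>Reduces tensoriality in the first slot to tensoriality in the second slot of the
  transposed form.\<close>

lemma lie_derivative_flip:
  "lie_derivative_form \<xi> (\<lambda>X Y. T Y X) X Y = lie_derivative_form \<xi> T Y X"
  by (simp add: lie_derivative_form_def fun_eq_iff)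

text \<open>The derivative of \<open>h\<close> in \<open>\<xi> p (h * T X Y)\<close> cancels the one
  that the Leibniz rule produces in the bracket of \<open>\<xi>\<close> with
  \<open>fun_scale h Y\<close>. The assumption \<open>closed\<close> is discharged by
  \<open>lie_bracket_closed\<close> once a frame is present.\<close>

lemma one_form_lie_derivative:
  assumes T: "bilinear_form T" and \<xi>: "\<xi> \<in> vector_fields A"
    and closed: "\<And>Y. Y \<in> vector_fields A \<Longrightarrow> lie_bracket \<xi> Y \<in> vector_fields A"
    and X: "X \<in> vector_fields A"
  shows "one_form (lie_derivative_form \<xi> T X)"
  unfolding one_form_def
proof (intro conjI ballI)
  note TX = bilinear_formD(1)[OF T X] bilinear_formD(1)[OF T closed[OF X]]
  note u = vector_field_tangent[OF \<xi>]
  fix Y assume Y: "Y \<in> vector_fields A"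
  have eq: "lie_derivative_form \<xi> T X Y
      = (\<lambda>p. \<xi> p (T X Y)) - T (lie_bracket \<xi> X) Y - T X (lie_bracket \<xi> Y)" for Y
    by (simp add: lie_derivative_form_def fun_eq_iff)
  show "lie_derivative_form \<xi> T X Y \<in> C_inf A"
    unfolding eq using Y closed
    by (intro C_inf_diff vector_field_smooth[OF \<xi>] one_formD(1)[OF TX(1)] one_formD(1)[OF TX(2)])
  show "lie_derivative_form \<xi> T X (Y + Z)
      = lie_derivative_form \<xi> T X Y + lie_derivative_form \<xi> T X Z"
    if Z: "Z \<in> vector_fields A" for Z
  proof -
    have "\<xi> p (T X Y + T X Z) = \<xi> p (T X Y) + \<xi> p (T X Z)" for p
      using Y Z by (intro tangent_vector_add[OF u] one_formD(1)[OF TX(1)])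
    then show ?thesis unfolding eq
      using Y Z closed
      by (simp add: fun_eq_iff one_formD(2)[OF TX(1)] one_formD(2)[OF TX(2)]
          lie_bracket_add_right[OF \<xi> Y Z])
  qed
  show "lie_derivative_form \<xi> T X (fun_scale h Y) = h * lie_derivative_form \<xi> T X Y"
    if h: "h \<in> C_inf A" for h
  proof -
    have "\<xi> p (h * T X Y) = \<xi> p h * T X Y p + h p * \<xi> p (T X Y)" for p
      using Y h by (intro tangent_vector_mult[OF u] one_formD(1)[OF TX(1)])
    then show ?thesis unfolding eq
      using Y h closed vector_field_smooth[OF \<xi>]
      by (simp add: fun_eq_iff one_formD(2,3)[OF TX(1)] one_formD(3)[OF TX(2)]
          lie_bracket_fun_scale_right[OF \<xi> Y h] vector_fields_fun_scale algebra_simps)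
  qed
qed

lemma bilinear_form_lie_derivative:
  assumes T: "bilinear_form T" and \<xi>: "\<xi> \<in> vector_fields A"
    and closed: "\<And>Y. Y \<in> vector_fields A \<Longrightarrow> lie_bracket \<xi> Y \<in> vector_fields A"
  shows "bilinear_form (lie_derivative_form \<xi> T)"
proof -
  have "bilinear_form (\<lambda>X Y. T Y X)"
    using T by (simp add: bilinear_form_def)
  from one_form_lie_derivative[OF this \<xi> closed] one_form_lie_derivative[OF T \<xi> closed]
  show ?thesis
    unfolding bilinear_form_def lie_derivative_flip[of _ T] by simp
qed

section \<open>Connections\<close>

lemma affine_connectionD:
  assumes "affine_connection A D" "X \<in> vector_fields A" "Y \<in> vector_fields A"
  shows "D X Y \<in> vector_fields A"
    "Z \<in> vector_fields A \<Longrightarrow> D (X + Y) Z = D X Z + D Y Z"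
    "Z \<in> vector_fields A \<Longrightarrow> D X (Y + Z) = D X Y + D X Z"
    "h \<in> C_inf A \<Longrightarrow> D (fun_scale h X) Y = fun_scale h (D X Y)"
    "h \<in> C_inf A \<Longrightarrow> D X (fun_scale h Y) = fun_scale (\<lambda>p. X p h) Y + fun_scale h (D X Y)"
  using assms unfolding affine_connection_def by blast+

lemma affine_connection_scaleR:
  assumes D: "affine_connection A D" "X \<in> vector_fields A" "Y \<in> vector_fields A"
  shows "D (c *\<^sub>R X) Y = c *\<^sub>R D X Y" "D X (c *\<^sub>R Y) = c *\<^sub>R D X Y"
  using affine_connectionD(4,5)[OF D C_inf_const[of c]]
    tangent_vector_const[OF vector_field_tangent[OF D(2)], of _ c]
    fun_scale_const[of 0 Y]
  by (simp_all add: fun_scale_const)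

lemma affine_connection_uminus:
  assumes D: "affine_connection A D" "X \<in> vector_fields A" "Y \<in> vector_fields A"
  shows "D (- X) Y = - D X Y" "D X (- Y) = - D X Y"
  using affine_connection_scaleR[OF D, of "-1"] by simp_all

lemma affine_connection_diff:
  assumes D: "affine_connection A D" "X \<in> vector_fields A" "Y \<in> vector_fields A"
    and Z: "Z \<in> vector_fields A"
  shows "D (X - Y) Z = D X Z - D Y Z" "D X (Y - Z) = D X Y - D X Z"
  using affine_connectionD(2)[OF D(1) D(2) vector_fields_uminus[OF D(3)] Z]
    affine_connectionD(3)[OF D(1) D(2) D(3) vector_fields_uminus[OF Z]]
    affine_connection_uminus(1)[OF D(1) D(3) Z] affine_connection_uminus(2)[OF D(1) D(2) Z]
  by simp_all

section \<open>Tensoriality of the curvature\<close>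

lemma curvature_add_left:
  assumes D: "affine_connection A D" and X: "X \<in> vector_fields A" "X' \<in> vector_fields A"
    and Y: "Y \<in> vector_fields A" and Z: "Z \<in> vector_fields A"
    and br: "lie_bracket X Y \<in> vector_fields A" "lie_bracket X' Y \<in> vector_fields A"
  shows "curvature D (X + X') Y Z = curvature D X Y Z + curvature D X' Y Z"
  using X Y Z br by (simp add: curvature_def affine_connectionD[OF D] lie_bracket_add_left)

lemma curvature_add_right:
  assumes D: "affine_connection A D" and X: "X \<in> vector_fields A"
    and Y: "Y \<in> vector_fields A" and Z: "Z \<in> vector_fields A" "Z' \<in> vector_fields A"
    and br: "lie_bracket X Y \<in> vector_fields A"
  shows "curvature D X Y (Z + Z') = curvature D X Y Z + curvature D X Y Z'"
  using X Y Z br by (simp add: curvature_def affine_connectionD[OF D])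

text \<open>The term with the derivative of \<open>h\<close> along \<open>Y\<close> arises twice,
  from differentiating \<open>fun_scale h (D X Z)\<close> and from the bracket, and cancels. In
  \<open>ricci\<close> the middle slot always holds a frame field, so linearity is established for
  the outer slots.\<close>

lemma curvature_fun_scale_left:
  assumes D: "affine_connection A D" and X: "X \<in> vector_fields A"
    and Y: "Y \<in> vector_fields A" and Z: "Z \<in> vector_fields A"
    and br: "lie_bracket X Y \<in> vector_fields A" and h: "h \<in> C_inf A"
  shows "curvature D (fun_scale h X) Y Z = fun_scale h (curvature D X Y Z)"
proof -
  note [simp] = affine_connectionD[OF D] affine_connection_diff[OF D]
    vector_fields_closed vector_field_smooth
  have "curvature D (fun_scale h X) Y Z
      = fun_scale h (D X (D Y Z)) - (fun_scale (\<lambda>p. Y p h) (D X Z) + fun_scale h (D Y (D X Z)))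
        - (fun_scale h (D (lie_bracket X Y) Z) - fun_scale (\<lambda>p. Y p h) (D X Z))"
    using X Y Z br h by (simp add: curvature_def lie_bracket_fun_scale_left)
  also have "\<dots> = fun_scale h (curvature D X Y Z)"
    by (simp add: curvature_def fun_eq_iff fun_scale_apply algebra_simps)
  finally show ?thesis .
qed

text \<open>The mixed first-order terms are symmetric in \<open>X\<close> and \<open>Y\<close> and
  drop out. The second derivatives of \<open>h\<close> combine to its derivative along the bracket,
  which the last term of the curvature removes.\<close>

lemma curvature_fun_scale_right:
  assumes D: "affine_connection A D" and X: "X \<in> vector_fields A"
    and Y: "Y \<in> vector_fields A" and Z: "Z \<in> vector_fields A"
    and br: "lie_bracket X Y \<in> vector_fields A" and h: "h \<in> C_inf A"
  shows "curvature D X Y (fun_scale h Z) = fun_scale h (curvature D X Y Z)"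
proof -
  note [simp] = affine_connectionD[OF D] vector_fields_closed vector_field_smooth
  have "D X (D Y (fun_scale h Z))
      = fun_scale (\<lambda>p. X p (\<lambda>q. Y q h)) Z + fun_scale (\<lambda>p. Y p h) (D X Z)
        + (fun_scale (\<lambda>p. X p h) (D Y Z) + fun_scale h (D X (D Y Z)))"
    if "X \<in> vector_fields A" "Y \<in> vector_fields A" for X Y
    using that Z h by simp
  from this[OF X Y] this[OF Y X]
  show ?thesis
    using X Y Z br h
    by (simp add: curvature_def lie_bracket_def[of X Y] fun_eq_iff fun_scale_apply algebra_simps)
qed

section \<open>Product structures and the canonical connection\<close>

lemma product_structureD:
  assumes "product_structure A J"
  shows "X \<in> vector_fields A \<Longrightarrow> endo_app J X \<in> vector_fields A"
    "X \<in> vector_fields A \<Longrightarrow> endo_app J (endo_app J X) = X"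
    "X \<in> vector_fields A \<Longrightarrow> Y \<in> vector_fields A \<Longrightarrow>
       endo_app J (X + Y) = endo_app J X + endo_app J Y"
    "X \<in> vector_fields A \<Longrightarrow> endo_app J (fun_scale h X) = fun_scale h (endo_app J X)"
proof -
  note * = assms[unfolded product_structure_def]
  have lin: "J p (c *\<^sub>R u + v) = c *\<^sub>R J p u + J p v"
    if "u \<in> tangent_space A p" "v \<in> tangent_space A p" for p u v c
    using * that by blast
  show "X \<in> vector_fields A \<Longrightarrow> endo_app J X \<in> vector_fields A" using * by blast
  show "X \<in> vector_fields A \<Longrightarrow> endo_app J (endo_app J X) = X"
    using * by (auto simp: endo_app_def vector_field_tangent)
  show "X \<in> vector_fields A \<Longrightarrow> Y \<in> vector_fields A \<Longrightarrow>
       endo_app J (X + Y) = endo_app J X + endo_app J Y"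
    using lin[of _ _ _ 1] vector_field_tangent by (intro ext) (simp add: endo_app_def)
  have z: "0 \<in> tangent_space A p" for p by (rule subspace_0[OF tangent_space_subspace])
  \<comment> \<open>\<open>lin\<close> treats sums and multiples together. Isolating the multiple
    means taking 0 as the second summand, whose image has to be known.\<close>
  have "J p 0 = 0" for p using lin[OF z z, of p 1] by simp
  then have "J p (c *\<^sub>R u) = c *\<^sub>R J p u" if "u \<in> tangent_space A p" for p u c
    using lin[OF that z, of c] by simp
  then show "X \<in> vector_fields A \<Longrightarrow> endo_app J (fun_scale h X) = fun_scale h (endo_app J X)"
    by (intro ext) (simp add: endo_app_def fun_scale_def vector_field_tangent)
qed

text \<open>As \<open>J\<close> is an involution, the correction term,
  \<open>cov_deriv_endo D J X\<close> applied to \<open>endo_app J Y\<close>, is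
  \<open>D X Y\<close> minus the \<open>J\<close>-conjugate of \<open>D X Y\<close>.\<close>

lemma canonical_connection_eq:
  assumes "affine_connection A D" "product_structure A J" "X \<in> vector_fields A" "Y \<in> vector_fields A"
  shows "canonical_connection D J X Y = (1/2) *\<^sub>R (D X Y + endo_app J (D X (endo_app J Y)))"
  using assms(4)
  by (simp add: canonical_connection_def cov_deriv_endo_def product_structureD[OF assms(2)]
      fun_eq_iff algebra_simps)

text \<open>In the Leibniz rule the conjugate connection also contributes the derivative of
  \<open>h\<close> times \<open>Y\<close>, since the outer \<open>J\<close> undoes the inner one.
  The two halves add up to the single term required.\<close>

lemma affine_canonical_connection:
  assumes D: "affine_connection A D" and J: "product_structure A J"
  shows "affine_connection A (canonical_connection D J)"
proof -
  note [simp] = affine_connectionD[OF D] product_structureD[OF J] vector_fields_closed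
    vector_field_smooth canonical_connection_eq[OF D J]
  show ?thesis
    unfolding affine_connection_def
  proof (intro conjI ballI)
    fix X Y assume [simp]: "X \<in> vector_fields A" "Y \<in> vector_fields A"
    show "canonical_connection D J X Y \<in> vector_fields A" by simp
    fix Z assume [simp]: "Z \<in> vector_fields A"
    show "canonical_connection D J (X + Y) Z
        = canonical_connection D J X Z + canonical_connection D J Y Z"
      "canonical_connection D J X (Y + Z)
        = canonical_connection D J X Y + canonical_connection D J X Z"
      by (simp_all add: scaleR_add_right)
  next
    fix h X Y assume [simp]: "h \<in> C_inf A" "X \<in> vector_fields A" "Y \<in> vector_fields A"
    show "canonical_connection D J (fun_scale h X) Y = fun_scale h (canonical_connection D J X Y)"
      "canonical_connection D J X (fun_scale h Y)
        = fun_scale (\<lambda>p. X p h) Y + fun_scale h (canonical_connection D J X Y)"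
      by (simp_all) (simp_all add: fun_eq_iff fun_scale_apply field_simps)
  qed
qed

end

section \<open>Pseudo-orthonormal frames\<close>

text \<open>\<open>frame_bracket\<close> asks for three brackets to be fields; closure under all
  brackets is derived from it in \<open>lie_bracket_closed\<close>.\<close>

locale pseudo_orthonormal_frame = smooth_manifold A
  for A :: "('p::topological_space, real ^ 3) chart set" +
  fixes g :: "'p form_field" and e1 e2 e3 :: "'p vector_field"
  assumes metric: "lorentzian_metric A g"
    and frame: "e1 \<in> vector_fields A" "e2 \<in> vector_fields A" "e3 \<in> vector_fields A"
    and gram: "\<And>p. form_app g e1 e1 p = 1" "\<And>p. form_app g e2 e2 p = 1"
      "\<And>p. form_app g e3 e3 p = -1"
      "\<And>p. form_app g e1 e2 p = 0" "\<And>p. form_app g e1 e3 p = 0" "\<And>p. form_app g e2 e3 p = 0"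
    and frame_bracket: "lie_bracket e1 e2 \<in> vector_fields A"
      "lie_bracket e1 e3 \<in> vector_fields A" "lie_bracket e2 e3 \<in> vector_fields A"
begin

lemma metric_sym: "X \<in> vector_fields A \<Longrightarrow> Y \<in> vector_fields A \<Longrightarrow> form_app g X Y = form_app g Y X"
  using metric[unfolded lorentzian_metric_def, THEN conjunct1, rule_format]
  by (simp add: form_app_def vector_field_tangent)

lemma metric_linear:
  assumes u: "u \<in> tangent_space A p" and w: "w \<in> tangent_space A p"
  shows "v \<in> tangent_space A p \<Longrightarrow> g p (u + v) w = g p u w + g p v w"
    "g p (c *\<^sub>R u) w = c * g p u w"
proof -
  note lin = metric[unfolded lorentzian_metric_def, THEN conjunct2, THEN conjunct1, rule_format,
      OF _ _ w]
  show "v \<in> tangent_space A p \<Longrightarrow> g p (u + v) w = g p u w + g p v w"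
    using lin[OF u, of v 1] by simp
  have z: "0 \<in> tangent_space A p" by (rule subspace_0[OF tangent_space_subspace])
  have "g p 0 w = 0" using lin[OF z z, of 1] by simp
  with lin[OF u z, of c] show "g p (c *\<^sub>R u) w = c * g p u w" by simp
qed

lemma metric_smooth: "X \<in> vector_fields A \<Longrightarrow> Y \<in> vector_fields A \<Longrightarrow> form_app g X Y \<in> C_inf A"
  using metric[unfolded lorentzian_metric_def] by blast

lemma bilinear_form_metric: "bilinear_form (form_app g)"
proof -
  have "one_form (\<lambda>Y. form_app g Y X)" if X: "X \<in> vector_fields A" for X
    unfolding one_form_def
    by (intro conjI ballI ext)
      (simp_all add: X metric_smooth[unfolded form_app_def] form_app_def fun_scale_def metric_linear vector_field_tangent)
  then show ?thesis
    unfolding bilinear_form_def one_form_def by (simp add: metric_sym vector_fields_closed)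
qed

lemmas metric_left = bilinear_formD(2)[OF bilinear_form_metric]
lemma gram': "\<And>p. form_app g e2 e1 p = 0" "\<And>p. form_app g e3 e1 p = 0" "\<And>p. form_app g e3 e2 p = 0"
  using gram metric_sym frame by metis+

text \<open>Pairing with the frame reads off coefficients, the timelike one with a sign. This yields
  the independence of the frame at each point as well as the expansion of tangent vectors.\<close>

lemma frame_comb_coeffs:
  fixes a b c p
  defines "v \<equiv> a *\<^sub>R e1 p + b *\<^sub>R e2 p + c *\<^sub>R e3 p"
  shows "g p v (e1 p) = a" "g p v (e2 p) = b" "g p v (e3 p) = - c"
proof -
  note t = vector_field_tangent[OF frame(1), of p] vector_field_tangent[OF frame(2), of p]
    vector_field_tangent[OF frame(3), of p]
  note s = subspace_add[OF tangent_space_subspace] subspace_scale[OF tangent_space_subspace]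
  show "g p v (e1 p) = a" "g p v (e2 p) = b" "g p v (e3 p) = - c"
    using gram[of p] gram'[of p] t
    by (simp_all add: v_def metric_linear s form_app_def)
qed

text \<open>Pseudo-orthonormal vectors are independent, and three of them exhaust a tangent space
  modelled on \<open>real ^ 3\<close>.\<close>

lemma tangent_vector_expansion:
  assumes v: "v \<in> tangent_space A p"
  shows "v = g p v (e1 p) *\<^sub>R e1 p + g p v (e2 p) *\<^sub>R e2 p - g p v (e3 p) *\<^sub>R e3 p"
proof -
  have neq: "e1 p \<noteq> e2 p" "e1 p \<noteq> e3 p" "e2 p \<noteq> e3 p"
    using gram[of p] by (auto simp: form_app_def)
  have "f x = 0"
    if "(\<Sum>x\<in>{e1 p, e2 p, e3 p}. f x *\<^sub>R x) = 0" and x: "x \<in> {e1 p, e2 p, e3 p}" for f x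
  proof -
    \<comment> \<open>Zero is written as a combination too, so that \<open>frame_comb_coeffs\<close>
      can be applied to both sides.\<close>
    from that(1) have 0: "f (e1 p) *\<^sub>R e1 p + f (e2 p) *\<^sub>R e2 p + f (e3 p) *\<^sub>R e3 p
        = 0 *\<^sub>R e1 p + 0 *\<^sub>R e2 p + 0 *\<^sub>R e3 p"
      using neq by (simp add: add.assoc)
    have "f (e1 p) = 0" "f (e2 p) = 0" "f (e3 p) = 0"
      using frame_comb_coeffs[where a = "f (e1 p)" and b = "f (e2 p)" and c = "f (e3 p)" and p = p,
          unfolded 0]
        frame_comb_coeffs[where a = 0 and b = 0 and c = 0 and p = p] by simp_all
    with x show "f x = 0" by auto
  qed
  then have "independent {e1 p, e2 p, e3 p}"
    by (intro independent_if_scalars_zero) simp_all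
  then have "tangent_space A p = span {e1 p, e2 p, e3 p}"
    using neq frame by (intro tangent_space_span) (auto simp: vector_field_tangent)
  with v obtain a b c where "v - a *\<^sub>R e1 p - b *\<^sub>R e2 p - c *\<^sub>R e3 p = 0"
    by (auto simp: span_insert)
  then have "v = a *\<^sub>R e1 p + b *\<^sub>R e2 p + c *\<^sub>R e3 p" by (simp add: algebra_simps)
  with frame_comb_coeffs[where a = a and b = b and c = c and p = p] show ?thesis by simp
qed

lemma frame_expansion:
  assumes "X \<in> vector_fields A"
  shows "X = fun_scale (form_app g X e1) e1 + fun_scale (form_app g X e2) e2
    - fun_scale (form_app g X e3) e3"
  using tangent_vector_expansion[OF vector_field_tangent[OF assms]]
  by (simp add: fun_eq_iff fun_scale_apply form_app_def)

text \<open>The frame generates the fields as a module over the smooth functions, because the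
  coefficients in \<open>frame_expansion\<close> are smooth.\<close>

lemma frame_induct:
  assumes X: "X \<in> vector_fields A"
    and e: "P e1" "P e2" "P e3"
    and add: "\<And>X Y. X \<in> vector_fields A \<Longrightarrow> Y \<in> vector_fields A \<Longrightarrow> P X \<Longrightarrow> P Y \<Longrightarrow> P (X + Y)"
    and scale: "\<And>h X. h \<in> C_inf A \<Longrightarrow> X \<in> vector_fields A \<Longrightarrow> P X \<Longrightarrow> P (fun_scale h X)"
  shows "P X"
proof -
  \<comment> \<open>The minus sign of the expansion is moved into the coefficient, leaving only sums
    and multiples.\<close>
  have "X = fun_scale (form_app g X e1) e1 + fun_scale (form_app g X e2) e2
    + fun_scale (- form_app g X e3) e3"
    using frame_expansion[OF X] by (simp add: fun_eq_iff fun_scale_apply)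
  moreover have "P \<dots>"
    using X frame e
    by (intro add scale) (simp_all add: vector_fields_closed metric_smooth C_inf_uminus)
  ultimately show ?thesis by simp
qed

lemma one_form_eq_0:
  assumes "one_form \<theta>" "\<theta> e1 = 0" "\<theta> e2 = 0" "\<theta> e3 = 0" "X \<in> vector_fields A"
  shows "\<theta> X = 0"
  using assms(5) by (rule frame_induct[where P = "\<lambda>X. \<theta> X = 0"]) (simp_all add: assms(2-4) one_formD[OF assms(1)])

lemma bilinear_form_eq_0:
  assumes T: "bilinear_form T"
    and 0: "T e1 e1 = 0" "T e1 e2 = 0" "T e1 e3 = 0" "T e2 e1 = 0" "T e2 e2 = 0" "T e2 e3 = 0"
      "T e3 e1 = 0" "T e3 e2 = 0" "T e3 e3 = 0"
    and "X \<in> vector_fields A" "Y \<in> vector_fields A"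
  shows "T X Y = 0"
proof (rule one_form_eq_0[OF bilinear_formD(1)[OF T]])
  show "T X e1 = 0" "T X e2 = 0" "T X e3 = 0"
    by (rule one_form_eq_0[OF bilinear_formD(2)[OF T]]; simp add: 0 frame assms)+
qed fact+

text \<open>Reducing to the frame avoids the symmetry of second derivatives in charts.\<close>

lemma lie_bracket_closed:
  assumes "X \<in> vector_fields A" "Y \<in> vector_fields A"
  shows "lie_bracket X Y \<in> vector_fields A"
proof -
  \<comment> \<open>By the Leibniz rule it is enough that the brackets of \<open>e\<close> with the
    frame are fields. This is used twice: for a frame member against \<open>Y\<close>, then for
    \<open>Y\<close> against \<open>X\<close>.\<close>
  have "lie_bracket e X \<in> vector_fields A"
    if "X \<in> vector_fields A" and e: "e \<in> vector_fields A"
      "lie_bracket e e1 \<in> vector_fields A" "lie_bracket e e2 \<in> vector_fields A"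
      "lie_bracket e e3 \<in> vector_fields A" for e X
    using that(1) by (rule frame_induct[where P = "\<lambda>X. lie_bracket e X \<in> vector_fields A"])
      (simp_all add: e lie_bracket_add_right lie_bracket_fun_scale_right vector_fields_closed
        vector_field_smooth)
  note step = this
  \<comment> \<open>Zero appears as a multiple of \<open>e\<close>, so that
    \<open>vector_fields_scaleR\<close> shows it to be a field.\<close>
  have self: "lie_bracket e e = 0 *\<^sub>R e" for e :: "'p vector_field"
    by (simp add: lie_bracket_def fun_eq_iff)
  have skew: "lie_bracket X Y \<in> vector_fields A" if "lie_bracket Y X \<in> vector_fields A"
    for X Y using vector_fields_uminus[OF that] lie_bracket_skew[of X Y] by simp
  have ee: "lie_bracket e e \<in> vector_fields A" if "e \<in> vector_fields A" for e
    using that unfolding self by (rule vector_fields_scaleR)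
  have "lie_bracket e Y \<in> vector_fields A" if "e \<in> {e1, e2, e3}" for e
    using that
    by (elim insertE emptyE; simp only:; intro step[OF assms(2)])
      (simp_all add: frame frame_bracket skew ee)
  then have "lie_bracket Y e1 \<in> vector_fields A" "lie_bracket Y e2 \<in> vector_fields A"
    "lie_bracket Y e3 \<in> vector_fields A"
    by (simp_all add: skew)
  then have "lie_bracket Y X \<in> vector_fields A"
    by (rule step[OF assms])
  then show ?thesis by (rule skew)
qed

lemma ricci_bilinear:
  assumes D: "affine_connection A D"
  shows "bilinear_form (ricci g e1 e2 e3 D)"
proof -
  have cl: "curvature D X Y Z \<in> vector_fields A"
    if "X \<in> vector_fields A" "Y \<in> vector_fields A" "Z \<in> vector_fields A" for X Y Z
    using that by (simp add: curvature_def affine_connectionD[OF D] vector_fields_closed lie_bracket_closed)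
  have "one_form (\<lambda>Y. form_app g (curvature D X W Y) W)"
    "one_form (\<lambda>Y. form_app g (curvature D Y W X) W)"
    if "X \<in> vector_fields A" "W \<in> vector_fields A" for X W
    using that cl unfolding one_form_def
    by (auto simp: curvature_add_left curvature_add_right curvature_fun_scale_left
        curvature_fun_scale_right D lie_bracket_closed one_formD[OF metric_left])
  note R = this
  show ?thesis
    unfolding bilinear_form_def ricci_def diff_conv_add_uminus
    by (intro ballI conjI one_form_plus one_form_minus R frame)
qed

end

section \<open>The structure on \<open>G\<^sub>6\<close>\<close>

text \<open>The Lie group enters through its global frame: structure constants, Gram matrix and the
  matrix of \<open>J\<close> are constant there, so all frame components below are
  constants.\<close>

locale G6_frame = pseudo_orthonormal_frame A g e1 e2 e3
  for A :: "('p::topological_space, real ^ 3) chart set" and g e1 e2 e3 +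
  fixes \<alpha> \<beta> \<gamma> \<delta> :: real and J :: "'p endo_field" and D :: "'p connection"
  assumes bracket: "lie_bracket e1 e2 = \<alpha> *\<^sub>R e2 + \<beta> *\<^sub>R e3"
      "lie_bracket e1 e3 = \<gamma> *\<^sub>R e2 + \<delta> *\<^sub>R e3" "lie_bracket e2 e3 = 0"
    and product: "product_structure A J"
    and J_frame: "endo_app J e1 = e1" "endo_app J e2 = e2" "endo_app J e3 = - e3"
    and levi: "levi_civita A g D"
begin

section \<open>The Levi-Civita connection on the frame\<close>

lemma affine: "affine_connection A D"
  using levi by (simp add: levi_civita_def)

lemma torsion_free:
  "X \<in> vector_fields A \<Longrightarrow> Y \<in> vector_fields A \<Longrightarrow> D X Y = D Y X + lie_bracket X Y"
  using levi unfolding levi_civita_def by (metis diff_add_cancel add.commute)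

text \<open>A constant product has derivative 0, so metric compatibility becomes skew-symmetry of
  the connection coefficients.\<close>

lemma metric_parallel:
  assumes "X \<in> vector_fields A" "Y \<in> vector_fields A" "Z \<in> vector_fields A"
    and "\<And>p. form_app g Y Z p = c"
  shows "form_app g (D X Y) Z p = - form_app g (D X Z) Y p"
proof -
  have "form_app g Y Z = (\<lambda>_. c)" using assms(4) by auto
  then have "X p (form_app g Y Z) = 0"
    using tangent_vector_const[OF vector_field_tangent[OF assms(1)]] by simp
  moreover have "X p (form_app g Y Z) = form_app g (D X Y) Z p + form_app g Y (D X Z) p"
    using levi assms(1-3) unfolding levi_civita_def by blast
  moreover have "form_app g Y (D X Z) = form_app g (D X Z) Y"
    using assms by (simp add: metric_sym affine_connectionD[OF affine])
  ultimately show ?thesis by simp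
qed

text \<open>Koszul's formula on the frame, in the only coefficients that enter \<open>\<nabla>\<^sup>0\<close>.\<close>

lemma levi_civita_coeffs:
  shows "form_app g (D e1 e1) e2 p = 0" "form_app g (D e2 e1) e2 p = - \<alpha>"
    "form_app g (D e3 e1) e2 p = (\<beta> - \<gamma>) / 2"
proof -
  have cl: "D X Y \<in> vector_fields A" if "X \<in> {e1, e2, e3}" "Y \<in> {e1, e2, e3}" for X Y
    using that frame by (intro affine_connectionD(1)[OF affine]) auto
  have tf: "D e1 e2 = D e2 e1 + (\<alpha> *\<^sub>R e2 + \<beta> *\<^sub>R e3)"
    "D e1 e3 = D e3 e1 + (\<gamma> *\<^sub>R e2 + \<delta> *\<^sub>R e3)" "D e2 e3 = D e3 e2"
    using torsion_free[OF frame(1,2)] torsion_free[OF frame(1,3)] torsion_free[OF frame(2,3)]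
    by (simp_all add: bracket)
  have 12: "form_app g (D e1 e2) Z p
      = form_app g (D e2 e1) Z p + \<alpha> * form_app g e2 Z p + \<beta> * form_app g e3 Z p"
    if "Z \<in> {e1, e2, e3}" for Z
  proof -
    have Z: "Z \<in> vector_fields A" using that frame by auto
    show ?thesis by (simp add: tf one_form_linear[OF metric_left[OF Z]] cl frame vector_fields_closed)
  qed
  have 13: "form_app g (D e1 e3) Z p
      = form_app g (D e3 e1) Z p + \<gamma> * form_app g e2 Z p + \<delta> * form_app g e3 Z p"
    if "Z \<in> {e1, e2, e3}" for Z
  proof -
    have Z: "Z \<in> vector_fields A" using that frame by auto
    show ?thesis by (simp add: tf one_form_linear[OF metric_left[OF Z]] cl frame vector_fields_closed)
  qed
  \<comment> \<open>Write a for the coefficient of \<open>D e3 e1\<close> along \<open>e2\<close>.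
    Skewness and vanishing torsion, applied in turn, give \<open>form_app g (D e1 e3) e2 p\<close>
    as both \<beta> - a and a + \<gamma>. The other two coefficients come from the first three
    relations.\<close>
  have "form_app g (D e1 e1) e2 p = - form_app g (D e1 e2) e1 p"
    "form_app g (D e2 e1) e1 p = - form_app g (D e2 e1) e1 p"
    "form_app g (D e1 e2) e2 p = - form_app g (D e1 e2) e2 p"
    "form_app g (D e1 e3) e2 p = - form_app g (D e1 e2) e3 p"
    "form_app g (D e2 e1) e3 p = - form_app g (D e2 e3) e1 p"
    "form_app g (D e3 e2) e1 p = - form_app g (D e3 e1) e2 p"
    by (rule metric_parallel; (rule frame gram gram'))+
  with 12[of e1] 12[of e2] 12[of e3] 13[of e2] gram[of p] gram'[of p] tf(3)
  show "form_app g (D e1 e1) e2 p = 0" "form_app g (D e2 e1) e2 p = - \<alpha>"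
    "form_app g (D e3 e1) e2 p = (\<beta> - \<gamma>) / 2"
    by simp_all
qed

section \<open>The canonical connection on the frame\<close>

abbreviation canonical :: "'p connection"  where
  "canonical \<equiv> canonical_connection D J"

lemma affine_canonical: "affine_connection A canonical"
  using affine product by (rule affine_canonical_connection)

text \<open>Half of \<open>W + endo_app J W\<close> is the projection to the plane of
  \<open>e1\<close> and \<open>e2\<close>, half of \<open>W - endo_app J W\<close> the one to the
  line of \<open>e3\<close>. The derivative of a frame member is orthogonal to it, so only the
  rotation in the plane remains.\<close>

lemma canonical_frame:
  assumes X: "X \<in> vector_fields A"
  shows "canonical X e1 = fun_scale (form_app g (D X e1) e2) e2"
    "canonical X e2 = fun_scale (- form_app g (D X e1) e2) e1"
    "canonical X e3 = 0"
proof -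
  have exp: "W = fun_scale (form_app g W e1) e1 + fun_scale (form_app g W e2) e2
        - fun_scale (form_app g W e3) e3"
      "endo_app J W = fun_scale (form_app g W e1) e1 + fun_scale (form_app g W e2) e2
        + fun_scale (form_app g W e3) e3" if W: "W \<in> vector_fields A" for W
  proof -
    let ?W = "fun_scale (form_app g W e1) e1 + fun_scale (form_app g W e2) e2
      + fun_scale (- form_app g W e3) e3"
    show 1: "W = fun_scale (form_app g W e1) e1 + fun_scale (form_app g W e2) e2
        - fun_scale (form_app g W e3) e3"
      using W by (rule frame_expansion)
    have "endo_app J W = endo_app J ?W"
      using 1 by (intro arg_cong[where f = "endo_app J"]) (simp add: fun_eq_iff fun_scale_apply)
    also have "\<dots> = fun_scale (form_app g W e1) e1 + fun_scale (form_app g W e2) e2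
        + fun_scale (- form_app g W e3) (- e3)"
      using W frame
      by (simp add: product_structureD[OF product] vector_fields_closed metric_smooth
          C_inf_uminus J_frame)
    also have "\<dots> = fun_scale (form_app g W e1) e1 + fun_scale (form_app g W e2) e2
        + fun_scale (form_app g W e3) e3"
      by (simp add: fun_eq_iff fun_scale_apply)
    finally show "endo_app J W = \<dots>" .
  qed
  have cl: "D X e1 \<in> vector_fields A" "D X e2 \<in> vector_fields A" "D X e3 \<in> vector_fields A"
    using X frame by (simp_all add: affine_connectionD[OF affine])
  have mp: "form_app g (D X e1) e1 p = - form_app g (D X e1) e1 p"
    "form_app g (D X e2) e2 p = - form_app g (D X e2) e2 p"
    "form_app g (D X e3) e3 p = - form_app g (D X e3) e3 p"
    "form_app g (D X e2) e1 p = - form_app g (D X e1) e2 p" for p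
    by (rule metric_parallel; (rule X frame gram gram'))+
  have half: "(1/2) *\<^sub>R (W + endo_app J W)
      = fun_scale (form_app g W e1) e1 + fun_scale (form_app g W e2) e2"
    "(1/2) *\<^sub>R (W - endo_app J W) = - fun_scale (form_app g W e3) e3"
    if "W \<in> vector_fields A" for W
  proof -
    have "W p f = form_app g W e1 p * e1 p f + form_app g W e2 p * e2 p f - form_app g W e3 p * e3 p f"
      "endo_app J W p f = form_app g W e1 p * e1 p f + form_app g W e2 p * e2 p f + form_app g W e3 p * e3 p f"
      for p f
      using exp(1)[OF that, THEN fun_cong, THEN fun_cong, of p f]
        exp(2)[OF that, THEN fun_cong, THEN fun_cong, of p f]
      by (simp_all add: fun_scale_apply)
    then show "(1/2) *\<^sub>R (W + endo_app J W)
      = fun_scale (form_app g W e1) e1 + fun_scale (form_app g W e2) e2"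
    "(1/2) *\<^sub>R (W - endo_app J W) = - fun_scale (form_app g W e3) e3"
      by (intro ext; simp add: fun_scale_apply)+
  qed
  have "canonical X e1 = (1/2) *\<^sub>R (D X e1 + endo_app J (D X e1))"
    "canonical X e2 = (1/2) *\<^sub>R (D X e2 + endo_app J (D X e2))"
    using X frame by (simp_all add: canonical_connection_eq[OF affine product] J_frame)
  then show "canonical X e1 = fun_scale (form_app g (D X e1) e2) e2"
    "canonical X e2 = fun_scale (- form_app g (D X e1) e2) e1"
    using mp by (simp_all add: half cl, simp_all add: fun_eq_iff fun_scale_apply)
  have "endo_app J (- W) = - endo_app J W" if "W \<in> vector_fields A" for W
    using product_structureD(4)[OF product that, of "\<lambda>_. -1"] by (simp add: fun_scale_const)
  \<comment> \<open>\<open>J\<close> reverses \<open>e3\<close>, so the conjugate term enters with a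
    minus sign and the other projection appears.\<close>
  then have "canonical X e3 = (1/2) *\<^sub>R (D X e3 - endo_app J (D X e3))"
    using X frame cl
    by (simp add: canonical_connection_eq[OF affine product] J_frame affine_connection_uminus[OF affine])
  then show "canonical X e3 = 0"
    using mp(3) by (simp add: half cl) (simp add: fun_eq_iff fun_scale_apply)
qed

lemma canonical_table:
  "canonical e1 e1 = 0" "canonical e1 e2 = 0" "canonical e1 e3 = 0"
  "canonical e2 e1 = (- \<alpha>) *\<^sub>R e2" "canonical e2 e2 = \<alpha> *\<^sub>R e1" "canonical e2 e3 = 0"
  "canonical e3 e1 = ((\<beta> - \<gamma>) / 2) *\<^sub>R e2" "canonical e3 e2 = (- ((\<beta> - \<gamma>) / 2)) *\<^sub>R e1"
  "canonical e3 e3 = 0"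
proof -
  have "form_app g (D e1 e1) e2 = (\<lambda>_. 0)" "form_app g (D e2 e1) e2 = (\<lambda>_. - \<alpha>)"
    "form_app g (D e3 e1) e2 = (\<lambda>_. (\<beta> - \<gamma>) / 2)"
    using levi_civita_coeffs by auto
  then show
    "canonical e1 e1 = 0" "canonical e1 e2 = 0" "canonical e1 e3 = 0"
    "canonical e2 e1 = (- \<alpha>) *\<^sub>R e2" "canonical e2 e2 = \<alpha> *\<^sub>R e1" "canonical e2 e3 = 0"
    "canonical e3 e1 = ((\<beta> - \<gamma>) / 2) *\<^sub>R e2" "canonical e3 e2 = (- ((\<beta> - \<gamma>) / 2)) *\<^sub>R e1"
    "canonical e3 e3 = 0"
    by (simp_all only: canonical_frame frame)
      (simp_all add: fun_eq_iff fun_scale_apply)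
qed

lemma bracket_table:
  "lie_bracket e2 e1 = (- \<alpha>) *\<^sub>R e2 + (- \<beta>) *\<^sub>R e3" "lie_bracket e3 e1 = (- \<gamma>) *\<^sub>R e2 + (- \<delta>) *\<^sub>R e3"
  "lie_bracket e3 e2 = 0" "lie_bracket e1 e1 = 0" "lie_bracket e2 e2 = 0" "lie_bracket e3 e3 = 0"
  using lie_bracket_skew[of e2 e1] lie_bracket_skew[of e3 e1] lie_bracket_skew[of e3 e2]
  by (simp_all add: bracket lie_bracket_def[of e1 e1] lie_bracket_def[of e2 e2] lie_bracket_def[of e3 e3]
      fun_eq_iff)

section \<open>The symmetrized Ricci tensor\<close>

abbreviation sym_ricci :: "'p form_on_fields" where
  "sym_ricci \<equiv> symmetrization (ricci g e1 e2 e3 canonical)"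

lemma bilinear_form_sym_ricci: "bilinear_form sym_ricci"
  using affine_canonical by (intro bilinear_form_symmetrization ricci_bilinear)

text \<open>\<open>r11\<close> is \<omega>([e1, e2]) and \<open>r23\<close> is half of
  \<omega>([e1, e3]). The half comes from symmetrizing: the Ricci tensor is nonzero at
  (\<open>e3\<close>, \<open>e2\<close>) at most, and zero at (\<open>e2\<close>,
  \<open>e3\<close>).\<close>

definition "r11 = - (\<alpha>\<^sup>2 - \<beta> * (\<beta> - \<gamma>) / 2)"
definition "r23 = - (\<alpha> * \<gamma> - \<delta> * (\<beta> - \<gamma>) / 2) / 2"

text \<open>Along each frame field the connection acts on the frame by a constant multiple of one
  infinitesimal rotation. These commute, so the curvature of two frame fields is -\<omega> of their
  bracket times that rotation, and only pairs with \<open>e1\<close> contribute.\<close>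

lemma ricci_frame:
  "ricci g e1 e2 e3 canonical e1 e1 = (\<lambda>_. r11)" "ricci g e1 e2 e3 canonical e1 e2 = (\<lambda>_. 0)"
  "ricci g e1 e2 e3 canonical e1 e3 = (\<lambda>_. 0)" "ricci g e1 e2 e3 canonical e2 e1 = (\<lambda>_. 0)"
  "ricci g e1 e2 e3 canonical e2 e2 = (\<lambda>_. r11)" "ricci g e1 e2 e3 canonical e2 e3 = (\<lambda>_. 0)"
  "ricci g e1 e2 e3 canonical e3 e1 = (\<lambda>_. 0)" "ricci g e1 e2 e3 canonical e3 e2 = (\<lambda>_. 2 * r23)"
  "ricci g e1 e2 e3 canonical e3 e3 = (\<lambda>_. 0)"
proof -
  have z0: "(0::'p vector_field) = 0 *\<^sub>R e1" by simp
  have z: "(0::'p vector_field) \<in> vector_fields A"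
    unfolding z0 by (rule vector_fields_scaleR[OF frame(1)])
  have N0: "canonical X 0 = 0" "canonical 0 X = 0" if "X \<in> vector_fields A" for X
    using affine_connection_scaleR[OF affine_canonical that frame(1), of 0]
      affine_connection_scaleR[OF affine_canonical frame(1) that, of 0] by simp_all
  note calc = curvature_def canonical_table bracket bracket_table frame vector_fields_closed N0 z
    affine_connectionD(2,3)[OF affine_canonical] affine_connection_scaleR[OF affine_canonical]
  have scale: "form_app g (c *\<^sub>R X) Y p = c * form_app g X Y p"
    if "X \<in> {e1, e2, e3}" "Y \<in> {e1, e2, e3}" for X Y c p
    using that frame by (auto simp: one_form_scaleR[OF metric_left])
  \<comment> \<open>\<open>?k\<close> is \<omega>(e3); \<open>?a\<close> and \<open>?b\<close> are
    -\<omega>([e1, e2]) and -\<omega>([e1, e3]).\<close>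
  let ?k = "(\<beta> - \<gamma>) / 2"
  let ?a = "\<alpha>\<^sup>2 - \<beta> * ?k" and ?b = "\<alpha> * \<gamma> - \<delta> * ?k"
  have "curvature canonical e1 e2 e1 = ?a *\<^sub>R e2" "curvature canonical e1 e2 e2 = (- ?a) *\<^sub>R e1"
    "curvature canonical e1 e3 e1 = ?b *\<^sub>R e2" "curvature canonical e1 e3 e2 = (- ?b) *\<^sub>R e1"
    "curvature canonical e2 e1 e1 = (- ?a) *\<^sub>R e2" "curvature canonical e2 e1 e2 = ?a *\<^sub>R e1"
    "curvature canonical e3 e1 e1 = (- ?b) *\<^sub>R e2" "curvature canonical e3 e1 e2 = ?b *\<^sub>R e1"
    by (simp_all only: calc) (simp_all add: fun_eq_iff power2_eq_square field_simps)
  moreover have "curvature canonical e2 e3 Y = 0" if "Y \<in> {e1, e2, e3}" for Y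
    using that by (elim insertE emptyE; simp only: calc; simp)
  moreover have "curvature canonical e3 e2 Y = 0" if "Y \<in> {e1, e2, e3}" for Y
    using that by (elim insertE emptyE; simp only: calc; simp)
  moreover have "curvature canonical X X Y = 0" if "X \<in> {e1, e2, e3}" "Y \<in> {e1, e2, e3}" for X Y
    using that by (elim insertE emptyE; simp only: calc; simp)
  moreover have "curvature canonical X Y e3 = 0" if "X \<in> {e1, e2, e3}" "Y \<in> {e1, e2, e3}" for X Y
    using that by (elim insertE emptyE; simp only: calc; simp)
  moreover note scale
  moreover have "form_app g 0 Y p = 0" if "Y \<in> {e1, e2, e3}" for Y p
    using scale[of e1 Y 0 p] that by simp
  ultimately show
    "ricci g e1 e2 e3 canonical e1 e1 = (\<lambda>_. r11)" "ricci g e1 e2 e3 canonical e1 e2 = (\<lambda>_. 0)"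
    "ricci g e1 e2 e3 canonical e1 e3 = (\<lambda>_. 0)" "ricci g e1 e2 e3 canonical e2 e1 = (\<lambda>_. 0)"
    "ricci g e1 e2 e3 canonical e2 e2 = (\<lambda>_. r11)" "ricci g e1 e2 e3 canonical e2 e3 = (\<lambda>_. 0)"
    "ricci g e1 e2 e3 canonical e3 e1 = (\<lambda>_. 0)" "ricci g e1 e2 e3 canonical e3 e2 = (\<lambda>_. 2 * r23)"
    "ricci g e1 e2 e3 canonical e3 e3 = (\<lambda>_. 0)"
    by (simp_all add: ricci_def fun_eq_iff[where ?'b = real] gram gram' r11_def r23_def)
qed

lemma sym_ricci_frame:
  "sym_ricci e1 e1 = (\<lambda>_. r11)" "sym_ricci e1 e2 = (\<lambda>_. 0)" "sym_ricci e1 e3 = (\<lambda>_. 0)"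
  "sym_ricci e2 e1 = (\<lambda>_. 0)" "sym_ricci e2 e2 = (\<lambda>_. r11)" "sym_ricci e2 e3 = (\<lambda>_. r23)"
  "sym_ricci e3 e1 = (\<lambda>_. 0)" "sym_ricci e3 e2 = (\<lambda>_. r23)" "sym_ricci e3 e3 = (\<lambda>_. 0)"
  by (simp_all add: symmetrization_def ricci_frame fun_eq_iff)

section \<open>The linear system for collineations\<close>

text \<open>The components (1,2), (1,3), (2,2), (2,3), (3,3) of the Lie derivative, in this order
  and up to nonzero constant factors; the component (1,1) vanishes identically.\<close>

definition collineation_system :: "real \<Rightarrow> real \<Rightarrow> real \<Rightarrow> bool" where
  "collineation_system l1 l2 l3 \<longleftrightarrow>
     (l2 * \<alpha> + l3 * \<gamma>) * r11 + (l2 * \<beta> + l3 * \<delta>) * r23 = 0 \<and>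
     (l2 * \<alpha> + l3 * \<gamma>) * r23 = 0 \<and>
     l1 * (\<alpha> * r11 + \<beta> * r23) = 0 \<and>
     l1 * (\<alpha> * r23 + \<gamma> * r11 + \<delta> * r23) = 0 \<and>
     l1 * (\<gamma> * r23) = 0"

text \<open>The Lie derivative is tensorial, so the nine frame pairs decide. There the Ricci
  components are constant, \<open>\<xi>\<close> annihilates them, and only the two bracket terms
  remain.\<close>

lemma lie_derivative_sym_ricci_eq_0_iff:
  fixes l1 l2 l3
  defines "\<xi> \<equiv> l1 *\<^sub>R e1 + l2 *\<^sub>R e2 + l3 *\<^sub>R e3"
  shows "(\<forall>X \<in> vector_fields A. \<forall>Y \<in> vector_fields A. lie_derivative_form \<xi> sym_ricci X Y = 0)
    \<longleftrightarrow> collineation_system l1 l2 l3"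
proof -
  let ?L = "lie_derivative_form \<xi> sym_ricci"
  have \<xi>: "\<xi> \<in> vector_fields A"
    unfolding \<xi>_def using frame by (intro vector_fields_closed)
  have br: "lie_bracket \<xi> e1 = (- (l2 * \<alpha> + l3 * \<gamma>)) *\<^sub>R e2 + (- (l2 * \<beta> + l3 * \<delta>)) *\<^sub>R e3"
    "lie_bracket \<xi> e2 = (l1 * \<alpha>) *\<^sub>R e2 + (l1 * \<beta>) *\<^sub>R e3"
    "lie_bracket \<xi> e3 = (l1 * \<gamma>) *\<^sub>R e2 + (l1 * \<delta>) *\<^sub>R e3"
    unfolding \<xi>_def
    by (simp_all only: lie_bracket_add_left lie_bracket_scaleR_left frame vector_fields_closed
        bracket bracket_table) (simp_all add: fun_eq_iff algebra_simps)
  have c: "\<xi> p (\<lambda>_. c) = 0" for p c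
    by (rule tangent_vector_const[OF vector_field_tangent[OF \<xi>]])
  have lin: "sym_ricci (a *\<^sub>R e2 + b *\<^sub>R e3) Y p = a * sym_ricci e2 Y p + b * sym_ricci e3 Y p"
    "sym_ricci Y (a *\<^sub>R e2 + b *\<^sub>R e3) p = a * sym_ricci Y e2 p + b * sym_ricci Y e3 p"
    if "Y \<in> vector_fields A" for Y a b p
    using frame
    by (simp_all add: one_form_linear[OF bilinear_formD(1)[OF bilinear_form_sym_ricci that]]
        one_form_linear[OF bilinear_formD(2)[OF bilinear_form_sym_ricci that]] vector_fields_closed)
  note L = lie_derivative_form_def br sym_ricci_frame lin frame c
  have L1: "?L e1 e1 = (\<lambda>_. 0)"
    "?L e1 e2 = (\<lambda>_. (l2 * \<alpha> + l3 * \<gamma>) * r11 + (l2 * \<beta> + l3 * \<delta>) * r23)"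
    "?L e1 e3 = (\<lambda>_. (l2 * \<alpha> + l3 * \<gamma>) * r23)"
    "?L e2 e1 = (\<lambda>_. (l2 * \<alpha> + l3 * \<gamma>) * r11 + (l2 * \<beta> + l3 * \<delta>) * r23)"
    "?L e2 e2 = (\<lambda>_. - 2 * (l1 * (\<alpha> * r11 + \<beta> * r23)))"
    "?L e2 e3 = (\<lambda>_. - (l1 * (\<alpha> * r23 + \<gamma> * r11 + \<delta> * r23)))"
    "?L e3 e1 = (\<lambda>_. (l2 * \<alpha> + l3 * \<gamma>) * r23)"
    "?L e3 e2 = (\<lambda>_. - (l1 * (\<alpha> * r23 + \<gamma> * r11 + \<delta> * r23)))"
    "?L e3 e3 = (\<lambda>_. - 2 * (l1 * (\<gamma> * r23)))"
    by (simp_all only: L) (simp_all add: fun_eq_iff algebra_simps)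
  have "bilinear_form ?L"
    using bilinear_form_sym_ricci \<xi> lie_bracket_closed[OF \<xi>] by (rule bilinear_form_lie_derivative)
  from bilinear_form_eq_0[OF this]
  have "(\<forall>X \<in> vector_fields A. \<forall>Y \<in> vector_fields A. ?L X Y = 0)
    \<longleftrightarrow> (\<forall>X \<in> {e1, e2, e3}. \<forall>Y \<in> {e1, e2, e3}. ?L X Y = 0)"
    using frame by auto
  also have "\<dots> \<longleftrightarrow> collineation_system l1 l2 l3"
    unfolding collineation_system_def ball_simps L1 zero_fun_def fun_eq_iff by auto
  finally show ?thesis .
qed

text \<open>For \<gamma> = 0 only \<alpha> * \<open>r11\<close> is left as a coefficient,
  multiplying \<open>l1\<close> and \<open>l2\<close>. For \<gamma> \<noteq> 0 also
  \<open>r23\<close> \<noteq> 0: the fifth equation kills \<open>l1\<close>, the second gives the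
  first linear relation, and the first equation then gives the other.\<close>

lemma collineation_system_iff:
  assumes "\<alpha> + \<delta> \<noteq> 0" "\<alpha> * \<gamma> - \<beta> * \<delta> = 0"
  shows "\<gamma> = 0 \<Longrightarrow> collineation_system l1 l2 l3
      \<longleftrightarrow> \<alpha> * (2 * \<alpha>\<^sup>2 - \<beta>\<^sup>2) = 0 \<or> l1 = 0 \<and> l2 = 0"
    "\<gamma> \<noteq> 0 \<Longrightarrow> collineation_system l1 l2 l3
      \<longleftrightarrow> l1 = 0 \<and> l2 * \<alpha> + l3 * \<gamma> = 0 \<and> l2 * \<beta> + l3 * \<delta> = 0"
proof -
  have r23: "r23 = - \<gamma> * (\<alpha> + \<delta>) / 4"
    using assms(2) by (simp add: r23_def field_simps)
  show "collineation_system l1 l2 l3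
      \<longleftrightarrow> l1 = 0 \<and> l2 * \<alpha> + l3 * \<gamma> = 0 \<and> l2 * \<beta> + l3 * \<delta> = 0" if "\<gamma> \<noteq> 0"
  proof -
    have "r23 \<noteq> 0" using that assms(1) by (simp add: r23)
    with that show ?thesis by (auto simp: collineation_system_def)
  qed
  show "collineation_system l1 l2 l3
      \<longleftrightarrow> \<alpha> * (2 * \<alpha>\<^sup>2 - \<beta>\<^sup>2) = 0 \<or> l1 = 0 \<and> l2 = 0" if "\<gamma> = 0"
  proof -
    have "r23 = 0" "r11 = - (2 * \<alpha>\<^sup>2 - \<beta>\<^sup>2) / 2"
      by (subst r23 r11_def, simp add: that power2_eq_square)+
    show ?thesis
      unfolding collineation_system_def \<open>r23 = 0\<close> \<open>r11 = _\<close> by (auto simp: that)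
  qed
qed

end

section \<open>The classification of the collineations\<close>

theorem theorem4p9:
  fixes \<alpha> \<beta> \<gamma> \<delta> :: real
    and G :: "('p::{t2_space, second_countable_topology}) monoid"
    and A :: "('p, real ^ 3) chart set"
    and g :: "'p form_field"
    and J :: "'p endo_field"
    and D :: "'p connection"
    and e1 e2 e3 :: "'p vector_field"
  defines "V \<equiv> ricci_collineations G A g J D e1 e2 e3"
  assumes "\<alpha> + \<delta> \<noteq> 0" and "\<alpha> * \<gamma> - \<beta> * \<delta> = 0"
    and "lie_group G A" and "connected (UNIV :: 'p set)"
    and "lorentzian_metric A g" and "left_invariant_form G A g"
    and "pseudo_orthonormal_basis G A g e1 e2 e3"
    and "lie_bracket e1 e2 = \<alpha> *\<^sub>R e2 + \<beta> *\<^sub>R e3"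
    and "lie_bracket e1 e3 = \<gamma> *\<^sub>R e2 + \<delta> *\<^sub>R e3"
    and "lie_bracket e2 e3 = 0"
    and "product_structure A J" and "left_invariant_endo G A J"
    and "endo_app J e1 = e1" and "endo_app J e2 = e2" and "endo_app J e3 = - e3"
    and "levi_civita A g D"
  shows "((\<exists>\<xi> \<in> V. \<xi> \<noteq> 0) \<longleftrightarrow>
           (\<gamma> = 0 \<and> \<alpha> * (2 * \<alpha>\<^sup>2 - \<beta>\<^sup>2) = 0) \<or>
           (\<gamma> = 0 \<and> \<alpha> * (2 * \<alpha>\<^sup>2 - \<beta>\<^sup>2) \<noteq> 0) \<or>
           (\<gamma> \<noteq> 0 \<and> \<alpha> = 0 \<and> \<beta> = 0 \<and> \<delta> \<noteq> 0) \<or>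
           (\<gamma> \<noteq> 0 \<and> \<alpha> \<noteq> 0 \<and> \<alpha> + \<beta> = 0 \<and> \<gamma> + \<delta> = 0 \<and> \<delta> \<noteq> 0) \<or>
           (\<gamma> \<noteq> 0 \<and> \<alpha> \<noteq> 0 \<and> \<alpha> = \<beta> \<and> \<gamma> = \<delta> \<and> \<delta> \<noteq> 0)) \<and>
         (\<gamma> = 0 \<and> \<alpha> * (2 * \<alpha>\<^sup>2 - \<beta>\<^sup>2) = 0 \<longrightarrow> V = span {e1, e2, e3}) \<and>
         (\<gamma> = 0 \<and> \<alpha> * (2 * \<alpha>\<^sup>2 - \<beta>\<^sup>2) \<noteq> 0 \<longrightarrow> V = span {e3}) \<and>
         (\<gamma> \<noteq> 0 \<and> \<alpha> = 0 \<and> \<beta> = 0 \<and> \<delta> \<noteq> 0 \<longrightarrow> V = span {e2}) \<and>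
         (\<gamma> \<noteq> 0 \<and> \<alpha> \<noteq> 0 \<and> \<alpha> + \<beta> = 0 \<and> \<gamma> + \<delta> = 0 \<and> \<delta> \<noteq> 0 \<longrightarrow>
            V = span {e2 + (\<alpha> / \<delta>) *\<^sub>R e3}) \<and>
         (\<gamma> \<noteq> 0 \<and> \<alpha> \<noteq> 0 \<and> \<alpha> = \<beta> \<and> \<gamma> = \<delta> \<and> \<delta> \<noteq> 0 \<longrightarrow>
            V = span {e2 - (\<alpha> / \<delta>) *\<^sub>R e3})"
proof -
  have mfd: "smooth_manifold A"
    using \<open>lie_group G A\<close> by unfold_locales (simp add: lie_group_def)
  note basis = \<open>pseudo_orthonormal_basis G A g e1 e2 e3\<close>[unfolded pseudo_orthonormal_basis_def]
  have inv: "left_invariant_fields G A = span {e1, e2, e3}" using basis by simp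
  then have "{e1, e2, e3} \<subseteq> vector_fields A"
    unfolding left_invariant_fields_def using span_superset[of "{e1, e2, e3}"] by blast
  then have e: "e1 \<in> vector_fields A" "e2 \<in> vector_fields A" "e3 \<in> vector_fields A"
    by auto
  have e23: "a *\<^sub>R e2 + b *\<^sub>R e3 \<in> vector_fields A" for a b
    by (intro smooth_manifold.vector_fields_closed[OF mfd] e)
  interpret G6_frame A g e1 e2 e3 \<alpha> \<beta> \<gamma> \<delta> J D
  proof unfold_locales
    show "smooth_atlas A" using mfd by (rule smooth_manifold.atlas)
    \<comment> \<open>The zero bracket is covered by \<open>e23\<close> with both coefficients
      0.\<close>
    show "lie_bracket e1 e2 \<in> vector_fields A" "lie_bracket e1 e3 \<in> vector_fields A"
      "lie_bracket e2 e3 \<in> vector_fields A"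
      using e23 e23[of 0 0] assms by simp_all
  qed (use assms basis e in blast)+
  define c where "c l1 l2 l3 = l1 *\<^sub>R e1 + l2 *\<^sub>R e2 + l3 *\<^sub>R e3" for l1 l2 l3
  have span: "\<xi> \<in> span {e1, e2, e3} \<longleftrightarrow> (\<exists>l1 l2 l3. \<xi> = c l1 l2 l3)" for \<xi>
    by (simp add: span_insert c_def diff_eq_eq algebra_simps)
  have V: "\<xi> \<in> V \<longleftrightarrow> (\<exists>l1 l2 l3. \<xi> = c l1 l2 l3 \<and> collineation_system l1 l2 l3)" for \<xi>
    unfolding V_def ricci_collineations_def mem_Collect_eq inv span
    using lie_derivative_sym_ricci_eq_0_iff[folded c_def] by metis
  note sys = collineation_system_iff[OF \<open>\<alpha> + \<delta> \<noteq> 0\<close> \<open>\<alpha> * \<gamma> - \<beta> * \<delta> = 0\<close>]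
  have case1: "V = span {e1, e2, e3}" if "\<gamma> = 0" "\<alpha> * (2 * \<alpha>\<^sup>2 - \<beta>\<^sup>2) = 0"
    using sys(1)[OF that(1)] that(2) by (simp add: set_eq_iff V span)
  have case2: "V = span {e3}" if "\<gamma> = 0" "\<alpha> * (2 * \<alpha>\<^sup>2 - \<beta>\<^sup>2) \<noteq> 0"
  proof -
    have "\<xi> \<in> V \<longleftrightarrow> (\<exists>k. \<xi> = c 0 0 k)" for \<xi>
      using sys(1)[OF that(1)] that(2) by (auto simp: V)
    then show ?thesis by (auto simp: set_eq_iff span_singleton c_def)
  qed
  \<comment> \<open>The last three cases share one form: the two relations between \<open>l2\<close>
    and \<open>l3\<close> describe a line of slope \<open>k\<close>, with \<open>k\<close> equal to
    0, \<alpha> / \<delta> and -(\<alpha> / \<delta>) in turn.\<close>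
  have case345: "V = span {e2 + k *\<^sub>R e3}"
    if "\<gamma> \<noteq> 0" "\<And>l2 l3. l2 * \<alpha> + l3 * \<gamma> = 0 \<and> l2 * \<beta> + l3 * \<delta> = 0 \<longleftrightarrow> l3 = l2 * k" for k
  proof -
    have "\<xi> \<in> V \<longleftrightarrow> (\<exists>l. \<xi> = c 0 l (l * k))" for \<xi>
      using sys(2)[OF that(1)] that(2) by (auto simp: V)
    moreover have "c 0 l (l * k) = l *\<^sub>R (e2 + k *\<^sub>R e3)" for l
      by (simp add: c_def scaleR_add_right)
    ultimately show ?thesis by (auto simp: set_eq_iff span_singleton)
  qed
  have case3: "V = span {e2}" if "\<gamma> \<noteq> 0" "\<alpha> = 0" "\<beta> = 0" "\<delta> \<noteq> 0"
    using case345[of 0] that by simp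
  have case4: "V = span {e2 + (\<alpha> / \<delta>) *\<^sub>R e3}"
    if "\<gamma> \<noteq> 0" "\<alpha> \<noteq> 0" "\<alpha> + \<beta> = 0" "\<gamma> + \<delta> = 0" "\<delta> \<noteq> 0"
  proof (rule case345)
    have "\<beta> = - \<alpha>" "\<gamma> = - \<delta>" using that by simp_all
    then show "l2 * \<alpha> + l3 * \<gamma> = 0 \<and> l2 * \<beta> + l3 * \<delta> = 0 \<longleftrightarrow> l3 = l2 * (\<alpha> / \<delta>)" for l2 l3
      using that(5) by (auto simp: field_simps)
  qed fact
  have case5: "V = span {e2 - (\<alpha> / \<delta>) *\<^sub>R e3}"
    if "\<gamma> \<noteq> 0" "\<alpha> \<noteq> 0" "\<alpha> = \<beta>" "\<gamma> = \<delta>" "\<delta> \<noteq> 0"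
  proof -
    have "l2 * \<alpha> + l3 * \<gamma> = 0 \<and> l2 * \<beta> + l3 * \<delta> = 0 \<longleftrightarrow> l3 = l2 * (- (\<alpha> / \<delta>))" for l2 l3
      using that(5) unfolding that(3,4)[symmetric] by (auto simp: field_simps that(4))
    from case345[OF that(1) this] show ?thesis by simp
  qed
  have c_0: "l1 = 0 \<and> l2 = 0 \<and> l3 = 0" if "c l1 l2 l3 = 0" for l1 l2 l3
  proof -
    have eq: "l1 *\<^sub>R e1 p + l2 *\<^sub>R e2 p + l3 *\<^sub>R e3 p = 0 *\<^sub>R e1 p + 0 *\<^sub>R e2 p + 0 *\<^sub>R e3 p" for p
      using fun_cong[OF that, of p] by (simp add: c_def)
    show ?thesis
      using frame_comb_coeffs[where a = l1 and b = l2 and c = l3, unfolded eq]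
        frame_comb_coeffs[where a = 0 and b = 0 and c = 0] by simp
  qed
  have nz: "e1 \<noteq> 0" "e3 \<noteq> 0" "e2 + k *\<^sub>R e3 \<noteq> 0" for k
    using c_0[of 1 0 0] c_0[of 0 0 1] c_0[of 0 1 k] by (auto simp: c_def)
  have ex0: "\<exists>\<xi>\<in>V. \<xi> \<noteq> 0" if "\<gamma> = 0"
    using case1[OF that] case2[OF that] nz(1,2) span_base[of e1 "{e1, e2, e3}"]
      span_base[of e3 "{e3}"] by (cases "\<alpha> * (2 * \<alpha>\<^sup>2 - \<beta>\<^sup>2) = 0") auto
  have ex: "\<exists>\<xi>\<in>V. \<xi> \<noteq> 0" if "V = span {v}" "v \<noteq> 0" for v
    using that span_base[of v "{v}"] by auto
  have ex3: "V = span {e2} \<Longrightarrow> \<exists>\<xi>\<in>V. \<xi> \<noteq> 0"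
    using ex[of e2] nz(3)[of 0] by simp
  have ex4: "V = span {e2 + (\<alpha> / \<delta>) *\<^sub>R e3} \<Longrightarrow> \<exists>\<xi>\<in>V. \<xi> \<noteq> 0"
    by (rule ex[OF _ nz(3)])
  have ex5: "V = span {e2 - (\<alpha> / \<delta>) *\<^sub>R e3} \<Longrightarrow> \<exists>\<xi>\<in>V. \<xi> \<noteq> 0"
    using ex[of "e2 - (\<alpha> / \<delta>) *\<^sub>R e3"] nz(3)[of "- (\<alpha> / \<delta>)"] by simp
  have nec: "\<alpha> = 0 \<and> \<beta> = 0 \<and> \<delta> \<noteq> 0 \<or>
      \<alpha> \<noteq> 0 \<and> \<alpha> + \<beta> = 0 \<and> \<gamma> + \<delta> = 0 \<and> \<delta> \<noteq> 0 \<or>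
      \<alpha> \<noteq> 0 \<and> \<alpha> = \<beta> \<and> \<gamma> = \<delta> \<and> \<delta> \<noteq> 0"
    if \<gamma>: "\<gamma> \<noteq> 0" and ex: "\<exists>\<xi>\<in>V. \<xi> \<noteq> 0"
  proof -
    obtain l1 l2 l3 where "c l1 l2 l3 \<noteq> 0" "collineation_system l1 l2 l3"
      using ex by (auto simp: V)
    then have l: "l2 \<noteq> 0 \<or> l3 \<noteq> 0" "l2 * \<alpha> + l3 * \<gamma> = 0" "l2 * \<beta> + l3 * \<delta> = 0"
      by (auto simp: sys(2)[OF \<gamma>] c_def)
    \<comment> \<open>Cramer's rule: each unknown times the determinant vanishes, so a nonzero
      solution forces the determinant to be 0.\<close>
    have "l2 * (\<alpha> * \<delta> - \<beta> * \<gamma>) = 0" "l3 * (\<alpha> * \<delta> - \<beta> * \<gamma>) = 0"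
      using l(2,3) by algebra+
    with l(1) have det: "\<alpha> * \<delta> = \<beta> * \<gamma>" by auto
    have orth: "\<alpha> * \<gamma> = \<beta> * \<delta>" using assms by simp
    show ?thesis
    proof (cases "\<alpha> = 0")
      \<comment> \<open>Here \<delta> \<noteq> 0 because \<alpha> + \<delta> \<noteq> 0, and
        \<open>orth\<close> then gives \<beta> = 0.\<close>
      case True
      with orth \<open>\<alpha> + \<delta> \<noteq> 0\<close> show ?thesis by simp
    next
      case False
      with orth \<gamma> have nz: "\<beta> \<noteq> 0" "\<delta> \<noteq> 0" by auto
      \<comment> \<open>Multiplying \<open>det\<close> by \<open>orth\<close> gives (\<alpha> *
        \<delta>) * (\<alpha> * \<gamma>) = (\<beta> * \<gamma>) * (\<beta> * \<delta>), which
        factors in this way.\<close>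
      have "(\<alpha> + \<beta>) * (\<alpha> - \<beta>) * (\<gamma> * \<delta>) = 0"
        using det orth by algebra
      with \<gamma> nz have "\<beta> = - \<alpha> \<or> \<beta> = \<alpha>" by auto
      then show ?thesis
      proof
        assume "\<beta> = - \<alpha>"
        with orth False have "\<alpha> * (\<gamma> + \<delta>) = 0" by (simp add: algebra_simps)
        with False nz \<open>\<beta> = - \<alpha>\<close> show ?thesis by simp
      next
        assume "\<beta> = \<alpha>"
        with orth False nz show ?thesis by simp
      qed
    qed
  qed
  show ?thesis
    using case1 case2 case3 case4 case5 ex0 ex3 ex4 ex5 nec by argo
qed

end
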